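(* Let $F_1, F_2$ be two simple closed convex curves in the plane $E^2$, oriented in the same way, of the same length, with marked points $P_1 \in F_1$ and $P_2 \in F_2$. Then there exists an orientation-preserving isometry of the plane that brings $F_1, F_2$ (by moving one of the curves relative to the other) to a pair of curves whose isometric combination is also a simple closed convex curve.
   Context: Let $F_1, F_2 \subset E^2$ be closed convex curves of the same length $s_0$ and with the same orientation, with marked points $P_1 \in F_1$, $P_2 \in F_2$. For $s \in [0,s_0]$ let $P_i(s)$ be the point of $F_i$ such that the arc of $F_i$ from $P_i$ to $P_i(s)$, in the direction of the orientation, has length $s$ (so $P_i(0)=P_i$), and let $r_i(s)$ be the position vector of $P_i(s)$. The isometric combination of $F_1$ and $F_2$ is the curve $F$ given by the radius-vector $r(s) = r_1(s) + r_2(s)$. *)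

theory Defs
  imports "HOL-Complex_Analysis.Complex_Analysis"
begin

text \<open>
  The Euclidean plane is the type \<open>complex\<close>. An oriented closed curve with a marked point is
  represented by a parametrization \<open>\<gamma>\<close> on the unit interval: its direction is the orientation, and
  its endpoint \<open>\<gamma> 0 = \<gamma> 1\<close> is the marked point. The parametrization is otherwise arbitrary; arc
  length enters only through \<open>arc_point\<close>.
\<close>

text \<open>A Jordan curve bounding a convex region.\<close>

definition simple_closed_convex_curve :: "(real \<Rightarrow> complex) \<Rightarrow> bool" where
  "simple_closed_convex_curve \<gamma> \<longleftrightarrow>
     simple_path \<gamma> \<and> pathfinish \<gamma> = pathstart \<gamma> \<and> convex (inside (path_image \<gamma>))"

text \<open>
  The winding number of a simple closed curve about every inside point is the same, \<open>1\<close>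
  (counterclockwise) or \<open>-1\<close> (clockwise).
\<close>

definition same_orientation :: "(real \<Rightarrow> complex) \<Rightarrow> (real \<Rightarrow> complex) \<Rightarrow> bool" where
  "same_orientation \<gamma>1 \<gamma>2 \<longleftrightarrow>
     (\<forall>z1 \<in> inside (path_image \<gamma>1). \<forall>z2 \<in> inside (path_image \<gamma>2).
        winding_number \<gamma>1 z1 = winding_number \<gamma>2 z2)"

text \<open>
  The length of \<open>\<gamma>\<close> restricted to \<open>{a..b}\<close>, as the supremum of the lengths of inscribed polygonal
  lines; it is \<open>\<infinity>\<close> for a non-rectifiable curve.
\<close>

definition curve_length :: "(real \<Rightarrow> complex) \<Rightarrow> real \<Rightarrow> real \<Rightarrow> ereal" where
  "curve_length \<gamma> a b =
     (SUP ts \<in> {ts. sorted ts \<and> set ts \<subseteq> {a..b}}.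
        ereal (\<Sum>i<length ts - 1. dist (\<gamma> (ts ! i)) (\<gamma> (ts ! Suc i))))"

text \<open>
  The point whose arc from the marked point, in the direction of the orientation, has length \<open>s\<close>.
  For a simple closed curve of finite length \<open>s0\<close> there is exactly one such point for each \<open>s\<close> in
  \<open>{0..s0}\<close>; other values of \<open>s\<close> are never used.
\<close>

definition arc_point :: "(real \<Rightarrow> complex) \<Rightarrow> real \<Rightarrow> complex" where
  "arc_point \<gamma> s = (THE p. \<exists>t \<in> {0..1}. p = \<gamma> t \<and> curve_length \<gamma> 0 t = ereal s)"

text \<open>
  The curve \<open>s \<mapsto> r1(s) + r2(s)\<close>, \<open>s \<in> {0..s0}\<close>, with its parameter rescaled by \<open>s = s0 * t\<close> to the
  unit interval, as the path predicates of the library require.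
\<close>

definition isometric_combination ::
    "real \<Rightarrow> (real \<Rightarrow> complex) \<Rightarrow> (real \<Rightarrow> complex) \<Rightarrow> real \<Rightarrow> complex" where
  "isometric_combination s0 \<gamma>1 \<gamma>2 = (\<lambda>t. arc_point \<gamma>1 (s0 * t) + arc_point \<gamma>2 (s0 * t))"

text \<open>
  An isometry of the plane is affine; its linear part maps the basis \<open>1, \<i>\<close> to \<open>u = f 1 - f 0\<close>,
  \<open>v = f \<i> - f 0\<close>, so its determinant is \<open>Re u * Im v - Im u * Re v\<close>.
\<close>

definition orientation_preserving_isometry :: "(complex \<Rightarrow> complex) \<Rightarrow> bool" where
  "orientation_preserving_isometry f \<longleftrightarrow>
     (\<forall>x y. dist (f x) (f y) = dist x y) \<and>
     0 < Re (f 1 - f 0) * Im (f \<i> - f 0) - Im (f 1 - f 0) * Re (f \<i> - f 0)"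

end

theory Submission
  imports Defs
begin

text \<open>
  Parametrize both curves by arc length and suppose first that they run counterclockwise. Their
  tangents are \<open>cis (\<theta>1 s)\<close> and \<open>cis (\<theta>2 s)\<close> with angles \<open>\<theta>1\<close>, \<open>\<theta>2\<close> that increase monotonically and make at
  most one full turn (\<open>oriented_loop_has_turning_tangent\<close>). After a rotation of the first curve by
  \<open>\<alpha>\<close> the tangent of the isometric combination is the sum of two unit vectors,

  \<open>cis (\<theta>1 s + \<alpha>) + cis (\<theta>2 s) = 2 * cos ((\<theta>1 s + \<alpha> - \<theta>2 s) / 2) * cis ((\<theta>1 s + \<alpha> + \<theta>2 s) / 2)\<close>.

  Its direction is monotone and makes at most one full turn, as long as the cosine is positive, that
  is, as long as \<open>\<bar>\<theta>1 s + \<alpha> - \<theta>2 s\<bar> < pi\<close> for all \<open>s\<close>. Such an \<open>\<alpha>\<close> exists if \<open>\<theta>1 - \<theta>2\<close> oscillates by less than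
  \<open>2 * pi\<close>. An oscillation by almost \<open>2 * pi\<close> would mean that on some arc one curve makes almost its
  whole turn while the other is almost straight; the first is then almost straight on the
  complementary arc. A chord is no longer than half the common length, so both arcs would be close
  to half of the curve, and each curve close to a doubly traversed segment, which compactness
  excludes (\<open>turning_gap\<close>).

  A closed curve with such a tangent lies on one side of each of its tangents (\<open>left_of_tangent\<close>)
  and is injective unless it retraces a segment (\<open>injective_unless_reversal\<close>), which for the sum
  would force a cusp of one of the given curves. An injective closed curve with supporting lines at
  all of its points bounds a convex region
  (\<open>supporting_lines_imp_simple_closed_convex_curve\<close>). Clockwise curves are
  reflected.

  Convex curves have corners, so all derivatives are right derivatives, and the tangent angle is
  obtained as the limit of a continuous argument of the chords.
\<close>

section \<open>Monotonicity from right derivatives\<close>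

text \<open>
  A convex curve has a tangent direction on either side of every point but may have corners, so
  monotonicity has to be read off from one-sided derivatives. If \<open>f\<close> dropped on \<open>{a..b}\<close>, a slightly
  tilted copy \<open>g\<close> with strictly positive right derivatives would still drop; at the last point where
  \<open>g\<close> is at least its starting value, \<open>g\<close> cannot be increasing to the right. The left
  end is exempt because the tangent angles below are not known to be continuous from the right.
\<close>

lemma right_derivative_nonneg_imp_le:
  fixes f :: "real \<Rightarrow> real"
  assumes ab: "a \<le> b" and cont: "continuous_on {a..b} f"
    and der: "\<And>x. a < x \<Longrightarrow> x < b \<Longrightarrow> (f has_real_derivative f' x) (at_right x)"
    and nonneg: "\<And>x. a < x \<Longrightarrow> x < b \<Longrightarrow> 0 \<le> f' x"
  shows "f a \<le> f b"
proof (rule ccontr)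
  assume "\<not> f a \<le> f b"
  then have lt: "f b < f a" by simp
  then have "a < b" using ab by (cases "a = b") auto
  define e where "e = (f a - f b) / (2 * (b - a))"
  have e: "e > 0" using lt \<open>a < b\<close> by (simp add: e_def)
  \<comment> \<open>tilting \<open>f\<close> slightly makes every right derivative strictly positive\<close>
  define g where "g x = f x + e * (x - a)" for x
  have cg: "continuous_on {a..b} g"
    unfolding g_def by (intro continuous_intros cont)
  have "e * (b - a) = (f a - f b) / 2"
    using \<open>a < b\<close> by (simp add: e_def field_simps)
  then have gba: "g b < g a" using lt by (simp add: g_def field_simps)
  \<comment> \<open>the starting point is moved off \<open>a\<close>, where no derivative is assumed\<close>
  obtain a' where a': "a < a'" "a' < b" "g a' > g b"
  proof -
    obtain x where x: "a \<le> x" "x \<le> b" "g x = (g a + g b) / 2"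
      using IVT2'[of g b "(g a + g b) / 2" a] gba ab cg by auto
    then have "x \<noteq> a" "x \<noteq> b" "g x > g b" using gba by auto
    then show thesis using that[of x] x by auto
  qed
  define S where "S = {x \<in> {a'..b}. g a' \<le> g x}"
  have "compact S"
  proof -
    have "closed S" unfolding S_def
      by (intro continuous_on_closed_Collect_le continuous_on_const
          continuous_on_subset[OF cg] closed_atLeastAtMost) (use a' in auto)
    moreover have "bounded S" unfolding S_def by (rule bounded_subset[of "{a'..b}"]) auto
    ultimately show ?thesis by (simp add: compact_eq_bounded_closed)
  qed
  moreover have "a' \<in> S" using a' by (auto simp: S_def)
  ultimately obtain c where c: "c \<in> S" "\<And>x. x \<in> S \<Longrightarrow> x \<le> c"
    using compact_attains_sup[of S] by auto
  have c1: "a < c" "c \<le> b" "g a' \<le> g c" using c(1) a' by (auto simp: S_def)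
  with a' have cb: "c < b" by (cases "c = b") auto
  have "(g has_real_derivative (f' c + e)) (at_right c)"
    unfolding g_def by (auto intro!: derivative_eq_intros der[OF c1(1) cb])
  then have "((\<lambda>y. (g y - g c) / (y - c)) \<longlongrightarrow> f' c + e) (at_right c)"
    by (simp add: has_field_derivative_iff)
  moreover have "f' c + e > 0" using nonneg[OF c1(1) cb] e by simp
  ultimately have "eventually (\<lambda>y. (g y - g c) / (y - c) > 0) (at_right c)"
    by (rule order_tendstoD(1))
  moreover have "eventually (\<lambda>y. y \<in> {c<..<b}) (at_right c)"
    by (rule eventually_at_right_real[OF cb])
  ultimately have "eventually (\<lambda>y. (g y - g c) / (y - c) > 0 \<and> y \<in> {c<..<b}) (at_right c)"
    by eventually_elim auto
  then obtain y where y: "(g y - g c) / (y - c) > 0" "c < y" "y < b"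
    using eventually_happens'[of "at_right c"] by (auto simp: trivial_limit_at_right_real)
  then have "g y > g c" by (simp add: zero_less_divide_iff)
  then have "y \<in> S" using y c1 c(1) by (auto simp: S_def)
  then show False using c(2)[of y] y by auto
qed

lemma right_derivative_nonpos_imp_ge:
  fixes f :: "real \<Rightarrow> real"
  assumes "a \<le> b" and "continuous_on {a..b} f"
    and "\<And>x. a < x \<Longrightarrow> x < b \<Longrightarrow> (f has_real_derivative f' x) (at_right x)"
    and "\<And>x. a < x \<Longrightarrow> x < b \<Longrightarrow> f' x \<le> 0"
  shows "f b \<le> f a"
proof -
  have "- f a \<le> - f b"
    by (rule right_derivative_nonneg_imp_le[where f' = "\<lambda>x. - f' x"])
      (use assms in \<open>auto intro: continuous_on_minus DERIV_minus\<close>)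
  then show ?thesis by simp
qed

lemma const_imp_right_derivative_0:
  fixes f :: "real \<Rightarrow> real"
  assumes "a < b" "a \<le> x" "x < b" and const: "\<And>y. a \<le> y \<Longrightarrow> y < b \<Longrightarrow> f y = f a"
    and der: "(f has_real_derivative D) (at_right x)"
  shows "D = 0"
proof -
  have "((\<lambda>y. (f y - f x) / (y - x)) \<longlongrightarrow> D) (at_right x)"
    using der by (simp add: has_field_derivative_iff)
  moreover have "((\<lambda>y. (f y - f x) / (y - x)) \<longlongrightarrow> 0) (at_right x)"
  proof (rule tendsto_eventually)
    have "eventually (\<lambda>y. y \<in> {x<..<b}) (at_right x)"
      by (rule eventually_at_right_real) fact
    then show "eventually (\<lambda>y. (f y - f x) / (y - x) = 0) (at_right x)"
    proof eventually_elim
      case (elim y)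
      then have "f y = f a" "f x = f a" using const[of y] const[of x] assms(1-3) by simp_all
      then show ?case by simp
    qed
  qed
  ultimately show ?thesis
    using tendsto_unique[of "at_right x"] by simp
qed

text \<open>
  The equality case, which is what decides injectivity below: a monotone function with equal values
  at the ends is constant.
\<close>

lemma right_derivative_nonneg_eq_imp_0:
  fixes f :: "real \<Rightarrow> real"
  assumes ab: "a \<le> b" and cont: "continuous_on {a..b} f"
    and der: "\<And>x. a \<le> x \<Longrightarrow> x < b \<Longrightarrow> (f has_real_derivative f' x) (at_right x)"
    and nonneg: "\<And>x. a \<le> x \<Longrightarrow> x < b \<Longrightarrow> 0 \<le> f' x"
    and le: "f b \<le> f a" and x: "a \<le> x" "x < b"
  shows "f' x = 0"
proof (rule const_imp_right_derivative_0[of a b x f])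
  show "f y = f a" if "a \<le> y" "y < b" for y
  proof -
    have "f a \<le> f y"
      using that by (intro right_derivative_nonneg_imp_le[of a y f f'])
        (auto intro: der nonneg continuous_on_subset[OF cont])
    moreover have "f y \<le> f b"
      using that by (intro right_derivative_nonneg_imp_le[of y b f f'])
        (auto intro: der nonneg continuous_on_subset[OF cont])
    ultimately show ?thesis using le by simp
  qed
qed (use x der in auto)

lemma right_derivative_pos_imp_less:
  fixes f :: "real \<Rightarrow> real"
  assumes ab: "a < b" and cont: "continuous_on {a..b} f"
    and der: "\<And>x. a < x \<Longrightarrow> x < b \<Longrightarrow> (f has_real_derivative f' x) (at_right x)"
    and pos: "\<And>x. a < x \<Longrightarrow> x < b \<Longrightarrow> 0 < f' x"
  shows "f a < f b"
proof -
  define m where "m = (a + b) / 2"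
  have m: "a < m" "m < b" using ab by (auto simp: m_def)
  have "f a \<le> f m"
    using m by (intro right_derivative_nonneg_imp_le[of a m f f'])
      (auto intro: der less_imp_le[OF pos] continuous_on_subset[OF cont])
  also have "f m < f b"
  proof (rule ccontr)
    assume "\<not> f m < f b"
    then have "f' m = 0"
      using m by (intro right_derivative_nonneg_eq_imp_0[of m b f f'])
        (auto intro: der less_imp_le[OF pos] continuous_on_subset[OF cont])
    then show False using pos[of m] m by simp
  qed
  finally show ?thesis .
qed

section \<open>Loops with a monotone tangent angle\<close>

lemma sin_nonpos_lower_half: "- pi \<le> u \<Longrightarrow> u \<le> 0 \<Longrightarrow> sin u \<le> 0" for u :: real
  using sin_ge_zero[of "-u"] by simp

lemma sin_nonpos_third: "pi \<le> u \<Longrightarrow> u \<le> 2 * pi \<Longrightarrow> sin u \<le> 0" for u :: real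
  using sin_ge_zero[of "u - pi"] by (simp add: sin_diff)

lemma sin_nonneg_lower: "- (2 * pi) \<le> u \<Longrightarrow> u \<le> - pi \<Longrightarrow> 0 \<le> sin u" for u :: real
  using sin_nonpos_third[of "- u"] by simp

lemma sin_0_upper: "sin u = 0 \<Longrightarrow> 0 \<le> u \<Longrightarrow> u \<le> pi \<Longrightarrow> u = 0 \<or> u = pi" for u :: real
  using sin_gt_zero[of u] by (cases "u = 0"; cases "u = pi"; force)

text \<open>
  A closed curve whose tangent turns monotonically by at most one full turn. The tangent is the right
  derivative, which exists at corners too, and the full turn is measured on the half-open interval:
  whatever angle is left over at the base point \<open>r 0 = r l\<close> is the corner there.
\<close>

locale turning_loop =
  fixes l :: real and r :: "real \<Rightarrow> complex" and \<rho> \<phi> :: "real \<Rightarrow> real"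
  assumes l_pos: "0 < l"
    and cont: "continuous_on {0..l} r"
    and closed: "r l = r 0"
    and \<phi>_mono: "\<And>x y. 0 \<le> x \<Longrightarrow> x \<le> y \<Longrightarrow> y < l \<Longrightarrow> \<phi> x \<le> \<phi> y"
    and \<phi>_total: "\<And>x. 0 \<le> x \<Longrightarrow> x < l \<Longrightarrow> \<phi> x \<le> \<phi> 0 + 2 * pi"
    and speed_pos: "\<And>x. 0 \<le> x \<Longrightarrow> x < l \<Longrightarrow> 0 < \<rho> x"
    and tangent: "\<And>x. 0 \<le> x \<Longrightarrow> x < l \<Longrightarrow>
      (r has_vector_derivative \<rho> x *\<^sub>R cis (\<phi> x)) (at_right x)"
begin

text \<open>The coordinates of \<open>r\<close> in the frame whose first axis has direction \<open>c\<close>.\<close>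

definition along :: "real \<Rightarrow> real \<Rightarrow> real" where "along c x = Re (cis (- c) * r x)"
definition across :: "real \<Rightarrow> real \<Rightarrow> real" where "across c x = Im (cis (- c) * r x)"

lemma frame_closed: "along c l = along c 0" "across c l = across c 0"
  by (simp_all add: along_def across_def closed)

lemma frame_cont:
  assumes "0 \<le> a" "b \<le> l"
  shows "continuous_on {a..b} (along c)" "continuous_on {a..b} (across c)"
  unfolding along_def across_def
  by (intro continuous_intros continuous_on_subset[OF cont]; use assms in auto)+

lemma frame_derivative:
  assumes "0 \<le> x" "x < l"
  shows "(along c has_real_derivative \<rho> x * cos (\<phi> x - c)) (at_right x)"
    and "(across c has_real_derivative \<rho> x * sin (\<phi> x - c)) (at_right x)"
proof -
  have d: "((\<lambda>x. cis (- c) * r x) has_vector_derivative cis (- c) * (\<rho> x *\<^sub>R cis (\<phi> x))) (at_right x)"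
    by (rule has_vector_derivative_mult_right[OF tangent[OF assms]])
  have e: "cis (- c) * (\<rho> x *\<^sub>R cis (\<phi> x)) = \<rho> x *\<^sub>R cis (\<phi> x - c)"
    by (simp add: cis_mult)
  show "(along c has_real_derivative \<rho> x * cos (\<phi> x - c)) (at_right x)"
    using bounded_linear.has_vector_derivative[OF bounded_linear_Re d]
    by (simp add: e along_def[abs_def] cos_diff algebra_simps has_real_derivative_iff_has_vector_derivative)
  show "(across c has_real_derivative \<rho> x * sin (\<phi> x - c)) (at_right x)"
    using bounded_linear.has_vector_derivative[OF bounded_linear_Im d]
    by (simp add: e across_def[abs_def] sin_diff algebra_simps has_real_derivative_iff_has_vector_derivative)
qed

lemma across_le:
  assumes "0 \<le> a" "a \<le> b" "b \<le> l"
    and "\<And>x. a < x \<Longrightarrow> x < b \<Longrightarrow> 0 \<le> sin (\<phi> x - c)"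
  shows "across c a \<le> across c b"
  by (rule right_derivative_nonneg_imp_le[of a b "across c" "\<lambda>x. \<rho> x * sin (\<phi> x - c)"])
    (use assms frame_cont[of a b] in \<open>auto intro!: frame_derivative mult_nonneg_nonneg less_imp_le[OF speed_pos]\<close>)

lemma across_ge:
  assumes "0 \<le> a" "a \<le> b" "b \<le> l"
    and "\<And>x. a < x \<Longrightarrow> x < b \<Longrightarrow> sin (\<phi> x - c) \<le> 0"
  shows "across c b \<le> across c a"
  by (rule right_derivative_nonpos_imp_ge[of a b "across c" "\<lambda>x. \<rho> x * sin (\<phi> x - c)"])
    (use assms frame_cont[of a b] in \<open>auto intro!: frame_derivative mult_nonneg_nonpos less_imp_le[OF speed_pos]\<close>)

lemma across_eq_imp_sin_0:
  assumes "0 \<le> a" "b \<le> l"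
    and "(\<forall>x. a \<le> x \<and> x < b \<longrightarrow> 0 \<le> sin (\<phi> x - c)) \<or> (\<forall>x. a \<le> x \<and> x < b \<longrightarrow> sin (\<phi> x - c) \<le> 0)"
    and eq: "across c b = across c a" and x: "a \<le> x" "x < b"
  shows "sin (\<phi> x - c) = 0"
proof -
  have ab: "a \<le> b" using x by simp
  have sp: "\<And>x. a \<le> x \<Longrightarrow> x < b \<Longrightarrow> 0 < \<rho> x" using assms(1,2) by (intro speed_pos) auto
  have "\<rho> x * sin (\<phi> x - c) = 0"
    using assms(3)
  proof
    assume *: "\<forall>x. a \<le> x \<and> x < b \<longrightarrow> 0 \<le> sin (\<phi> x - c)"
    show ?thesis
      by (rule right_derivative_nonneg_eq_imp_0[of a b "across c" "\<lambda>x. \<rho> x * sin (\<phi> x - c)"])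
        (use assms(1,2) ab eq x * sp in \<open>auto intro!: frame_cont frame_derivative mult_nonneg_nonneg less_imp_le[OF sp]\<close>)
  next
    assume *: "\<forall>x. a \<le> x \<and> x < b \<longrightarrow> sin (\<phi> x - c) \<le> 0"
    have "- (\<rho> x * sin (\<phi> x - c)) = 0"
      by (rule right_derivative_nonneg_eq_imp_0[of a b "\<lambda>x. - across c x" "\<lambda>x. - (\<rho> x * sin (\<phi> x - c))"])
        (use assms(1,2) ab eq x * sp in \<open>auto intro!: continuous_on_minus DERIV_minus frame_cont frame_derivative
          mult_nonneg_nonpos less_imp_le[OF sp]\<close>)
    then show ?thesis by simp
  qed
  then show ?thesis using sp[OF x] by simp
qed

lemma along_less:
  assumes "0 \<le> a" "a < b" "b \<le> l" "\<And>x. a < x \<Longrightarrow> x < b \<Longrightarrow> 0 < cos (\<phi> x - c)"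
  shows "along c a < along c b"
  by (rule right_derivative_pos_imp_less[of a b "along c" "\<lambda>x. \<rho> x * cos (\<phi> x - c)"])
    (use assms in \<open>auto intro!: frame_cont frame_derivative mult_pos_pos speed_pos\<close>)

lemma along_greater:
  assumes "0 \<le> a" "a < b" "b \<le> l" "\<And>x. a < x \<Longrightarrow> x < b \<Longrightarrow> cos (\<phi> x - c) < 0"
  shows "along c b < along c a"
proof -
  have "- along c a < - along c b"
    by (rule right_derivative_pos_imp_less[of a b "\<lambda>x. - along c x" "\<lambda>x. - (\<rho> x * cos (\<phi> x - c))"])
      (use assms in \<open>auto intro!: continuous_on_minus DERIV_minus frame_cont frame_derivative mult_pos_neg speed_pos\<close>)
  then show ?thesis by simp
qed

text \<open>
  The distance from the tangent line at \<open>s\<close> changes at the rate \<open>\<rho> x * sin (\<phi> x - \<phi> s)\<close>. Going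
  forward from \<open>s\<close> it increases until \<open>\<phi>\<close> has turned by \<open>pi\<close> and decreases afterwards, and the same
  holds going backward. As the total turning is at most \<open>2 * pi\<close>, it cannot exceed \<open>pi\<close> on both
  sides before the base point is reached, so the distance is nonnegative at the base point; together with the
  value \<open>0\<close> at \<open>s\<close> this makes it nonnegative on every piece where it is monotone.
\<close>

theorem left_of_tangent:
  assumes s: "0 \<le> s" "s < l" and x: "0 \<le> x" "x \<le> l"
  shows "across (\<phi> s) s \<le> across (\<phi> s) x"
proof -
  let ?c = "\<phi> s"
  have hi: "\<phi> y - ?c \<le> 2 * pi" if "0 \<le> y" "y < l" for y
    using \<phi>_total[OF that] \<phi>_mono[of 0 s] s by simp
  have lo: "- (2 * pi) \<le> \<phi> y - ?c" if "0 \<le> y" "y < l" for y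
    using \<phi>_total[OF s] \<phi>_mono[of 0 y] that by simp
  have up: "across ?c s \<le> across ?c z"
    if z: "s \<le> z" "z \<le> l" "\<And>y. s < y \<Longrightarrow> y < z \<Longrightarrow> \<phi> y \<le> ?c + pi" for z
  proof (rule across_le)
    show "0 \<le> sin (\<phi> y - ?c)" if y: "s < y" "y < z" for y
      using z(3)[OF y] \<phi>_mono[of s y] y z(2) s by (intro sin_ge_zero; linarith)
  qed (use s z in auto)
  have down: "across ?c s \<le> across ?c z"
    if z: "0 \<le> z" "z \<le> s" "\<And>y. z < y \<Longrightarrow> y < s \<Longrightarrow> ?c - pi \<le> \<phi> y" for z
  proof (rule across_ge)
    show "sin (\<phi> y - ?c) \<le> 0" if y: "z < y" "y < s" for y
      using z(3)[OF y] \<phi>_mono[of y s] y z(1) s by (intro sin_nonpos_lower_half; linarith)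
  qed (use s z in auto)
  have base: "across ?c s \<le> across ?c 0"
  proof (cases "?c - pi \<le> \<phi> 0")
    case True
    show ?thesis
    proof (rule down)
      show "?c - pi \<le> \<phi> y" if "0 < y" "y < s" for y
        using True \<phi>_mono[of 0 y] that s by simp
    qed (use s in auto)
  next
    case False
    have "across ?c s \<le> across ?c l"
    proof (rule up)
      show "\<phi> y \<le> ?c + pi" if "s < y" "y < l" for y
        using False \<phi>_total[of y] that s by simp
    qed (use s in auto)
    then show ?thesis by (simp add: frame_closed)
  qed
  consider "x = l" | "s \<le> x" "x < l" "\<phi> x \<le> ?c + pi" | "s \<le> x" "x < l" "\<phi> x > ?c + pi"
    | "x < s" "?c - pi \<le> \<phi> x" | "x < s" "?c - pi > \<phi> x"
    using x by linarith
  then show ?thesis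
  proof cases
    case 1
    then show ?thesis using base by (simp add: frame_closed)
  next
    case 2
    show ?thesis
    proof (rule up)
      show "\<phi> y \<le> ?c + pi" if "s < y" "y < x" for y
        using 2 \<phi>_mono[of y x] that s by simp
    qed (use 2 in auto)
  next
    case 3
    have "across ?c l \<le> across ?c x"
    proof (rule across_ge)
      show "sin (\<phi> y - ?c) \<le> 0" if y: "x < y" "y < l" for y
        using 3 \<phi>_mono[of x y] hi[of y] y x by (intro sin_nonpos_third) auto
    qed (use x 3 in auto)
    then show ?thesis using base by (simp add: frame_closed)
  next
    case 4
    show ?thesis
    proof (rule down)
      show "?c - pi \<le> \<phi> y" if "x < y" "y < s" for y
        using 4 \<phi>_mono[of x y] that s x by simp
    qed (use 4 x in auto)
  next
    case 5
    have "across ?c 0 \<le> across ?c x"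
    proof (rule across_le)
      show "0 \<le> sin (\<phi> y - ?c)" if y: "0 < y" "y < x" for y
        using 5 \<phi>_mono[of y x] lo[of y] y x s by (intro sin_nonneg_lower) auto
    qed (use x 5 in auto)
    then show ?thesis using base by simp
  qed
qed

text \<open>
  A segment immediately retraced. This is the only way in which a loop with a monotone tangent can
  fail to be injective.
\<close>

definition reversal :: bool where
  "reversal \<longleftrightarrow> (\<exists>p a q c. 0 \<le> p \<and> p < a \<and> a < q \<and> q \<le> l \<and>
     (\<forall>x. p < x \<and> x < a \<longrightarrow> \<phi> x = c) \<and> (\<forall>x. a < x \<and> x < q \<longrightarrow> \<phi> x = c + pi))"

text \<open>
  Suppose \<open>r s = r t\<close>. On an arc between these two parameters the distance from the tangent at \<open>s\<close>
  is monotone but has equal ends, so \<open>\<phi>\<close> is restricted there to multiples of \<open>pi\<close> from \<open>\<phi> s\<close>. If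
  \<open>\<phi>\<close> turns by more than \<open>pi\<close> between \<open>s\<close> and \<open>t\<close>, this applies to the complementary arc from \<open>t\<close>
  through the base point to \<open>s\<close>, which is then straight and cannot return to its start. Otherwise it
  applies to the arc from \<open>s\<close> to \<open>t\<close>, which is straight or has a single jump by \<open>pi\<close>, a reversal.
\<close>

theorem injective_unless_reversal:
  assumes nr: "\<not> reversal"
  shows "inj_on r {0..<l}"
proof (rule linorder_inj_onI)
  show "r s \<noteq> r t" if st: "s < t" and "s \<in> {0..<l}" and "t \<in> {0..<l}" for s t
  proof
    assume eq: "r s = r t"
    have s: "0 \<le> s" "s < l" and t: "0 \<le> t" "t < l" using that by auto
    let ?c = "\<phi> s"
    have eqf: "across ?c t = across ?c s" "along ?c t = along ?c s"
      by (simp_all add: across_def along_def eq)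
    show False
    proof (cases "\<exists>y. s < y \<and> y < t \<and> \<phi> y > ?c + pi")
      case True
      then obtain y where y: "s < y" "y < t" "\<phi> y > ?c + pi" by blast
      have late: "\<phi> x - ?c > pi" "\<phi> x - ?c \<le> 2 * pi" if "t \<le> x" "x < l" for x
        using \<phi>_mono[of y x] \<phi>_total[of x] \<phi>_mono[of 0 s] y that s by auto
      have early: "\<phi> x - ?c > - pi" "\<phi> x - ?c \<le> 0" if "0 \<le> x" "x < s" for x
        using \<phi>_total[of y] \<phi>_mono[of 0 x] \<phi>_mono[of x s] y that s t by auto
      have sl: "sin (\<phi> x - ?c) \<le> 0" if "t \<le> x" "x < l" for x
        using late[OF that] by (intro sin_nonpos_third) auto
      have se: "sin (\<phi> x - ?c) \<le> 0" if "0 \<le> x" "x < s" for x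
        using early[OF that] by (intro sin_nonpos_lower_half) auto
      have "across ?c l \<le> across ?c t" by (rule across_ge) (use t sl in auto)
      moreover have "across ?c s \<le> across ?c 0" by (rule across_ge) (use s se in auto)
      ultimately have e: "across ?c l = across ?c t" "across ?c s = across ?c 0"
        using eqf frame_closed by auto
      have "cos (\<phi> x - ?c) > 0" if x: "t \<le> x" "x < l" for x
      proof -
        have "sin (\<phi> x - ?c) = 0"
          by (rule across_eq_imp_sin_0[of t l]) (use t sl e x in auto)
        then have "sin (\<phi> x - ?c - pi) = 0" by (simp add: sin_diff)
        then have "\<phi> x - ?c - pi = pi"
          using sin_0_upper[of "\<phi> x - ?c - pi"] late[OF x] by auto
        then have "\<phi> x - ?c = 2 * pi" by simp
        then show ?thesis by simp
      qed
      then have 1: "along ?c t < along ?c l" by (intro along_less) (use t in auto)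
      have "cos (\<phi> x - ?c) > 0" if x: "0 \<le> x" "x < s" for x
      proof -
        have "sin (\<phi> x - ?c) = 0"
          by (rule across_eq_imp_sin_0[of 0 s]) (use s se e x in auto)
        then have "sin (- (\<phi> x - ?c)) = 0" by (simp only: sin_minus)
        then have "- (\<phi> x - ?c) = 0"
          using sin_0_upper[of "- (\<phi> x - ?c)"] early[OF x] by auto
        then have "\<phi> x - ?c = 0" by simp
        then show ?thesis by simp
      qed
      then have "along ?c 0 \<le> along ?c s"
        using along_less[of 0 s ?c] s by (cases "s = 0") force+
      with 1 show False using eqf frame_closed by simp
    next
      case False
      have rng: "0 \<le> \<phi> x - ?c" "\<phi> x - ?c \<le> pi" if "s \<le> x" "x < t" for x
      proof -
        show "0 \<le> \<phi> x - ?c" using \<phi>_mono[of s x] that s t by simp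
        show "\<phi> x - ?c \<le> pi" using False that by (cases "x = s") force+
      qed
      have two: "\<phi> x = ?c \<or> \<phi> x = ?c + pi" if x: "s \<le> x" "x < t" for x
      proof -
        have "sin (\<phi> x - ?c) = 0"
          by (rule across_eq_imp_sin_0[of s t])
            (use s t x eqf rng in \<open>auto intro!: sin_ge_zero\<close>)
        then show ?thesis using sin_0_upper[of "\<phi> x - ?c"] rng[OF x] by auto
      qed
      define S where "S = {x. s < x \<and> x < t \<and> \<phi> x = ?c}"
      show False
      proof (cases "S = {}")
        case True
        have "\<phi> x = ?c + pi" if "s < x" "x < t" for x
          using True two[of x] that by (auto simp: S_def)
        then have "along ?c t < along ?c s"
          by (intro along_greater) (use s t st in auto)
        then show False using eqf by simp
      next
        case ne: False
        define a where "a = Sup S"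
        have bdd: "bdd_above S" by (auto simp: S_def bdd_above_def intro!: exI[of _ t])
        have sa: "s < a"
        proof -
          obtain x where "x \<in> S" using ne by auto
          then show ?thesis using cSup_upper[OF _ bdd, of x] by (auto simp: S_def a_def)
        qed
        have at: "a \<le> t" unfolding a_def by (rule cSup_least[OF ne]) (auto simp: S_def)
        have before: "\<phi> x = ?c" if x: "s < x" "x < a" for x
        proof -
          obtain y where "y \<in> S" "x < y"
            using x less_cSup_iff[OF ne bdd] by (auto simp: a_def)
          then have "\<phi> x \<le> ?c" using \<phi>_mono[of x y] x s t by (auto simp: S_def)
          then show ?thesis using \<phi>_mono[of s x] x s t at by auto
        qed
        have after: "\<phi> x = ?c + pi" if x: "a < x" "x < t" for x
        proof -
          have "x \<notin> S" using cSup_upper[OF _ bdd, of x] x by (auto simp: a_def)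
          then show ?thesis using two[of x] x sa by (auto simp: S_def)
        qed
        show False
        proof (cases "a = t")
          case True
          have "along ?c s < along ?c t"
            by (rule along_less) (use s t st before True in auto)
          then show False using eqf by simp
        next
          case False
          with at have "a < t" by simp
          have reversal
            unfolding reversal_def
            by (rule exI[of _ s], rule exI[of _ a], rule exI[of _ t], rule exI[of _ ?c])
              (use s t sa \<open>a < t\<close> before after in auto)
          then show False using nr by simp
        qed
      qed
    qed
  qed
qed auto

end

section \<open>The sum of two unit-speed loops\<close>

locale unit_speed_loop = turning_loop l r "\<lambda>_. 1" \<theta>
  for l :: real and r :: "real \<Rightarrow> complex" and \<theta> :: "real \<Rightarrow> real" +
  assumes lipschitz: "\<And>x y. 0 \<le> x \<Longrightarrow> x \<le> y \<Longrightarrow> y \<le> l \<Longrightarrow> dist (r x) (r y) \<le> y - x"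
    and inj: "inj_on r {0..<l}"
begin

lemma along_growth:
  assumes "0 \<le> a" "a \<le> b" "b \<le> l" and ge: "\<And>x. a < x \<Longrightarrow> x < b \<Longrightarrow> k \<le> cos (\<theta> x - c)"
  shows "k * (b - a) \<le> along c b - along c a"
proof -
  have "along c a - k * a \<le> along c b - k * b"
  proof (rule right_derivative_nonneg_imp_le[where f = "\<lambda>x. along c x - k * x"
        and f' = "\<lambda>x. cos (\<theta> x - c) - k"])
    show "continuous_on {a..b} (\<lambda>x. along c x - k * x)"
      using assms by (intro continuous_intros frame_cont) auto
    show "((\<lambda>x. along c x - k * x) has_real_derivative cos (\<theta> x - c) - k) (at_right x)"
      if "a < x" "x < b" for x
      using frame_derivative(1)[of x c] that assms
      by (auto intro!: derivative_eq_intros)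
  qed (use assms in auto)
  then show ?thesis by (simp add: algebra_simps)
qed

lemma along_diff_le_dist: "along c b - along c a \<le> dist (r a) (r b)"
proof -
  have "along c b - along c a = Re (cis (- c) * (r b - r a))"
    by (simp add: along_def algebra_simps)
  also have "\<dots> \<le> norm (cis (- c) * (r b - r a))" by (rule complex_Re_le_cmod)
  also have "\<dots> = dist (r a) (r b)" by (simp add: norm_mult dist_norm norm_minus_commute)
  finally show ?thesis .
qed

lemma straight:
  assumes "0 \<le> a" "a \<le> b" "b \<le> l" and c: "\<And>x. a < x \<Longrightarrow> x < b \<Longrightarrow> \<theta> x = c"
  shows "r b - r a = (b - a) *\<^sub>R cis c"
proof -
  have 1: "b - a \<le> along c b - along c a"
    using along_growth[of a b 1 c] assms by auto
  have 2: "along c b - along c a \<le> b - a"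
    using along_diff_le_dist[of c b a] lipschitz[of a b] assms by auto
  have 3: "across c b = across c a"
    using across_le[of a b c] across_ge[of a b c] assms by auto
  have "cis (- c) * (r b - r a) = of_real (b - a)"
    using 1 2 3 by (simp add: along_def across_def complex_eq_iff algebra_simps)
  then have "cis c * (cis (- c) * (r b - r a)) = cis c * of_real (b - a)" by simp
  then show ?thesis by (simp add: mult.assoc[symmetric] cis_mult scaleR_conv_of_real mult.commute)
qed

text \<open>
  At a corner between two straight pieces the turning is less than \<open>pi\<close>: a larger jump would put the
  second piece on the wrong side of the tangent of the first, and a jump of exactly \<open>pi\<close> would
  retrace it.
\<close>

lemma no_sharp_corner:
  assumes b: "0 \<le> b" "b < a" "a < q" "q \<le> l"
    and before: "\<And>x. b < x \<Longrightarrow> x < a \<Longrightarrow> \<theta> x = c"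
    and after: "\<And>x. a < x \<Longrightarrow> x < q \<Longrightarrow> \<theta> x = c + d"
    and d: "pi \<le> d" "d < 2 * pi"
  shows False
proof -
  define h where "h = min (a - b) (q - a) / 2"
  have h: "0 < h" "b < a - h" "a + h < q" using b by (auto simp: h_def min_def field_simps)
  have x: "\<theta> (a - h) = c" using before h by auto
  have "r a - r (a - h) = h *\<^sub>R cis c"
    using straight[of "a - h" a c] h b before by auto
  moreover have "r (a + h) - r a = h *\<^sub>R cis (c + d)"
    using straight[of a "a + h" "c + d"] h b after by auto
  ultimately have diff: "r (a + h) - r (a - h) = h *\<^sub>R cis c + h *\<^sub>R cis (c + d)" by (simp add: algebra_simps)
  have "across c (a - h) \<le> across c (a + h)"
    using left_of_tangent[of "a - h" "a + h"] x h b by auto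
  then have "0 \<le> Im (cis (- c) * (r (a + h) - r (a - h)))"
    by (simp add: across_def algebra_simps)
  also have "cis (- c) * (r (a + h) - r (a - h)) = h *\<^sub>R 1 + h *\<^sub>R cis d"
    unfolding diff by (simp add: algebra_simps scaleR_conv_of_real cis_mult)
  finally have "0 \<le> h * sin d" by simp
  then have "0 \<le> sin d" using h by (simp add: zero_le_mult_iff)
  moreover have "sin d < 0" if "d \<noteq> pi" using sin_lt_zero[of d] d that by auto
  ultimately have "d = pi" by force
  then have "r (a + h) = r (a - h)" using diff by (simp add: complex_eq_iff)
  then show False using inj_onD[OF inj, of "a + h" "a - h"] h b by auto
qed

end

lemma norm_sum_eq_imp_eq:
  fixes a b :: complex
  assumes "norm a \<le> h" "norm b \<le> h" "norm (a + b) = 2 * h"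
  shows "a = b"
proof -
  have "(norm (a + b))\<^sup>2 + (norm (a - b))\<^sup>2 = 2 * (norm a)\<^sup>2 + 2 * (norm b)\<^sup>2"
    by (simp add: power2_norm_eq_inner inner_add_left inner_add_right inner_diff_left inner_diff_right inner_commute)
  moreover have "(norm a)\<^sup>2 \<le> h\<^sup>2" "(norm b)\<^sup>2 \<le> h\<^sup>2"
    using assms by (auto intro: power_mono)
  moreover have "(norm (a + b))\<^sup>2 = 4 * h\<^sup>2" using assms(3) by (simp add: power_mult_distrib)
  ultimately have "(norm (a - b))\<^sup>2 \<le> 0" by linarith
  then show ?thesis by simp
qed

text \<open>
  If the chord were as long as the arc, both halves of the loop would be segments with the same ends,
  and their midpoints would be a double point. The midpoint of the second half may lie on either side
  of the base point, hence the case distinction for \<open>m'\<close>.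
\<close>

lemma (in unit_speed_loop) not_two_straight_halves:
  assumes st: "0 \<le> s" "s \<le> t" "t \<le> l" and half: "t - s = l / 2"
  shows "dist (r s) (r t) < t - s"
proof (rule ccontr)
  assume "\<not> ?thesis"
  then have d: "dist (r s) (r t) = t - s" using lipschitz[of s t] st by simp
  define h where "h = l / 4"
  have h: "h > 0" "t = s + 2 * h" "l = 4 * h" using l_pos half by (auto simp: h_def)
  have mid: "2 * m = r s + r t" if "dist (r s) m \<le> h" "dist m (r t) \<le> h" for m
  proof -
    have "m - r s = r t - m"
      by (rule norm_sum_eq_imp_eq[of _ h]) (use that d h in \<open>auto simp: dist_norm norm_minus_commute\<close>)
    then show ?thesis by (simp add: algebra_simps)
  qed
  have m1: "2 * r (s + h) = r s + r t"
    by (rule mid) (use lipschitz[of s "s + h"] lipschitz[of "s + h" t] st h in auto)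
  define m' where "m' = (if t + h < l then t + h else s - h)"
  have m2: "2 * r m' = r s + r t"
  proof (cases "t + h < l")
    case True
    have "dist (r (t + h)) (r s) \<le> dist (r (t + h)) (r l) + dist (r 0) (r s)"
      unfolding closed by (rule dist_triangle)
    also have "\<dots> \<le> (l - (t + h)) + s"
      using lipschitz[of "t + h" l] lipschitz[of 0 s] st h True by auto
    finally have "dist (r s) (r (t + h)) \<le> h" using h by (simp add: dist_commute)
    moreover have "dist (r (t + h)) (r t) \<le> h"
      using True lipschitz[of t "t + h"] st h by (simp add: dist_commute)
    ultimately show ?thesis unfolding m'_def using True by (simp add: mid)
  next
    case False
    have "dist (r (s - h)) (r t) \<le> dist (r 0) (r (s - h)) + dist (r t) (r l)"
      unfolding closed by (metis add.commute dist_commute dist_triangle)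
    also have "\<dots> \<le> (s - h) + (l - t)"
      using lipschitz[of 0 "s - h"] lipschitz[of t l] st h False by auto
    finally have "dist (r (s - h)) (r t) \<le> h" using h by simp
    moreover have "dist (r s) (r (s - h)) \<le> h"
      using False lipschitz[of "s - h" s] st h by (simp add: dist_commute)
    ultimately show ?thesis unfolding m'_def using False by (simp add: mid)
  qed
  have "2 * r (s + h) = 2 * r m'" unfolding m1 m2 ..
  then have "r (s + h) = r m'" by simp
  then have "s + h = m'"
    by (rule inj_onD[OF inj]) (use st h in \<open>auto simp: m'_def\<close>)
  then show False using h by (auto simp: m'_def split: if_splits)
qed

lemma cis_sum: "cis a + cis b = (2 * cos ((a - b) / 2)) *\<^sub>R cis ((a + b) / 2)"
proof -
  have a: "a = (a + b) / 2 + (a - b) / 2" and b: "b = (a + b) / 2 - (a - b) / 2"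
    by (simp_all add: field_simps)
  show ?thesis
    by (subst (1) a, subst (3) b) (simp add: complex_eq_iff cos_add sin_add cos_diff sin_diff)
qed

locale unit_speed_loop_pair = one: unit_speed_loop l r1 \<theta>1 + two: unit_speed_loop l r2 \<theta>2
  for l r1 \<theta>1 r2 \<theta>2
begin

text \<open>
  The defect \<open>l - (dist (r2 s) (r2 t) + dist (r1 s) (r1 t))\<close> measures how far the arc of one curve and
  the complementary arc of the other are from both being straight. A chord is bounded by both of its
  arcs, so the defect is nonnegative, and it can vanish only when \<open>t - s = l / 2\<close> and both curves
  consist of two straight halves. Compactness makes the bound uniform, so that no limits of the
  tangent angles at corners need to be considered.
\<close>

lemma defect_bounded_below:
  obtains \<eta> where "0 < \<eta>"
    "\<And>s t. 0 \<le> s \<Longrightarrow> s \<le> t \<Longrightarrow> t \<le> l \<Longrightarrow> dist (r2 s) (r2 t) + dist (r1 s) (r1 t) \<le> l - \<eta>"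
proof -
  define T where "T = {p. 0 \<le> fst p \<and> fst p \<le> snd p \<and> snd p \<le> l}"
  define G where "G p = dist (r2 (fst p)) (r2 (snd p)) + dist (r1 (fst p)) (r1 (snd p))" for p
  have "closed T" unfolding T_def
    by (intro closed_Collect_conj closed_Collect_le continuous_intros)
  moreover have "T \<subseteq> {0..l} \<times> {0..l}" by (auto simp: T_def)
  then have "bounded T" by (rule bounded_subset[rotated]) (intro bounded_Times bounded_closed_interval)
  ultimately have "compact T" by (simp add: compact_eq_bounded_closed)
  moreover have "(0, 0) \<in> T" using one.l_pos by (simp add: T_def)
  moreover have "continuous_on T G"
    unfolding G_def
    by (intro continuous_intros continuous_on_compose2[OF one.cont] continuous_on_compose2[OF two.cont])
      (auto simp: T_def)
  ultimately obtain p where p: "p \<in> T" "\<And>q. q \<in> T \<Longrightarrow> G q \<le> G p"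
    using continuous_attains_sup[of T G] by blast
  obtain s t where pst: "p = (s, t)" by (cases p)
  have st: "0 \<le> s" "s \<le> t" "t \<le> l" using p(1) by (auto simp: T_def pst)
  have direct: "dist (r2 s) (r2 t) \<le> t - s" "dist (r1 s) (r1 t) \<le> t - s"
    using one.lipschitz two.lipschitz st by auto
  have "dist (r1 s) (r1 t) \<le> dist (r1 0) (r1 s) + dist (r1 t) (r1 l)"
    unfolding one.closed by (metis add.commute dist_commute dist_triangle)
  also have "\<dots> \<le> s + (l - t)" using one.lipschitz[of 0 s] one.lipschitz[of t l] st by auto
  finally have around: "dist (r1 s) (r1 t) \<le> s + (l - t)" .
  have "dist (r2 s) (r2 t) \<le> dist (r2 0) (r2 s) + dist (r2 t) (r2 l)"
    unfolding two.closed by (metis add.commute dist_commute dist_triangle)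
  also have "\<dots> \<le> s + (l - t)" using two.lipschitz[of 0 s] two.lipschitz[of t l] st by auto
  finally have around2: "dist (r2 s) (r2 t) \<le> s + (l - t)" .
  have "G p < l"
  proof (cases "t - s = l / 2")
    case True
    then show ?thesis
      using one.not_two_straight_halves[OF st] two.not_two_straight_halves[OF st]
      by (simp add: G_def pst)
  next
    case False
    then show ?thesis using direct around around2 unfolding G_def pst by simp
  qed
  then show thesis
    using that[of "l - G p"] p(2) by (force simp: T_def G_def)
qed

text \<open>
  If \<open>r1\<close> turned by almost \<open>2 * pi\<close> more than \<open>r2\<close> between \<open>s\<close> and \<open>t\<close>, then \<open>r2\<close> would be almost
  straight there, and \<open>r1\<close>, having used up its full turn, almost straight on the complementary arc.
  The two chords would have total length almost \<open>l\<close>, the common length of the two curves, against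
  the bound on the defect.
\<close>

lemma turning_gap_one_sided:
  obtains \<epsilon> where "0 < \<epsilon>"
    "\<And>s t. 0 \<le> s \<Longrightarrow> s \<le> t \<Longrightarrow> t < l \<Longrightarrow> (\<theta>1 t - \<theta>1 s) - (\<theta>2 t - \<theta>2 s) \<le> 2 * pi - \<epsilon>"
proof -
  obtain \<eta> where \<eta>: "0 < \<eta>"
    "\<And>s t. 0 \<le> s \<Longrightarrow> s \<le> t \<Longrightarrow> t \<le> l \<Longrightarrow> dist (r2 s) (r2 t) + dist (r1 s) (r1 t) \<le> l - \<eta>"
    using defect_bounded_below by blast
  have l: "0 < l" by (rule one.l_pos)
  have "\<eta> \<le> l" using \<eta>(2)[of 0 0] l by simp
  \<comment> \<open>directions within \<open>arccos k\<close> of a fixed one shorten the chords by at most half of the defect \<open>\<eta>\<close>\<close>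
  define k where "k = 1 - \<eta> / (2 * l)"
  have "\<eta> / (2 * l) > 0" "\<eta> / (2 * l) \<le> 1 / 2"
    using \<eta>(1) \<open>\<eta> \<le> l\<close> l by (auto simp: field_simps)
  then have k: "0 < k" "k < 1" by (auto simp: k_def)
  have kl: "k * l = l - \<eta> / 2" using l by (simp add: k_def field_simps)
  define \<epsilon> where "\<epsilon> = arccos k"
  have \<epsilon>: "0 < \<epsilon>" "\<epsilon> < pi" "cos \<epsilon> = k"
    using k arccos_lt_bounded[of k] cos_arccos[of k] by (auto simp: \<epsilon>_def)
  have cos_ge: "k \<le> cos u" if "\<bar>u\<bar> \<le> \<epsilon>" for u
    using cos_monotone_0_pi_le[of "\<bar>u\<bar>" \<epsilon>] that \<epsilon> by simp
  have "(\<theta>1 t - \<theta>1 s) - (\<theta>2 t - \<theta>2 s) \<le> 2 * pi - \<epsilon>" if st: "0 \<le> s" "s \<le> t" "t < l" for s t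
  proof (rule ccontr)
    assume "\<not> ?thesis"
    then have gt: "(\<theta>1 t - \<theta>1 s) - (\<theta>2 t - \<theta>2 s) > 2 * pi - \<epsilon>" by simp
    have "\<theta>2 s \<le> \<theta>2 t" "\<theta>1 t \<le> \<theta>1 0 + 2 * pi" "\<theta>1 0 \<le> \<theta>1 s"
      using two.\<phi>_mono[of s t] one.\<phi>_total[of t] one.\<phi>_mono[of 0 s] st by auto
    then have big: "\<theta>1 t - \<theta>1 s > 2 * pi - \<epsilon>" and small: "\<theta>2 t - \<theta>2 s < \<epsilon>"
      using gt by linarith+
    have A: "k * (t - s) \<le> two.along (\<theta>2 s) t - two.along (\<theta>2 s) s"
    proof (rule two.along_growth)
      show "k \<le> cos (\<theta>2 x - \<theta>2 s)" if "s < x" "x < t" for x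
        using two.\<phi>_mono[of s x] two.\<phi>_mono[of x t] small that st by (intro cos_ge) auto
    qed (use st in auto)
    let ?c = "\<theta>1 s"
    have B: "k * (s - 0) \<le> one.along ?c s - one.along ?c 0"
    proof (rule one.along_growth)
      show "k \<le> cos (\<theta>1 x - ?c)" if "0 < x" "x < s" for x
        using one.\<phi>_mono[of x s] one.\<phi>_mono[of 0 x] one.\<phi>_total[of t] big that st
        by (intro cos_ge) auto
    qed (use st in auto)
    have C: "k * (l - t) \<le> one.along ?c l - one.along ?c t"
    proof (rule one.along_growth)
      fix x assume x: "t < x" "x < l"
      have "k \<le> cos (2 * pi - (\<theta>1 x - ?c))"
        using one.\<phi>_mono[of t x] one.\<phi>_total[of x] one.\<phi>_mono[of 0 s] big x st
        by (intro cos_ge) auto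
      then show "k \<le> cos (\<theta>1 x - ?c)" by simp
    qed (use st in auto)
    have "k * l \<le> (two.along (\<theta>2 s) t - two.along (\<theta>2 s) s) + (one.along ?c s - one.along ?c t)"
      using A B C one.frame_closed(1)[of ?c] by (simp add: algebra_simps)
    also have "\<dots> \<le> dist (r2 s) (r2 t) + dist (r1 s) (r1 t)"
      using two.along_diff_le_dist[of "\<theta>2 s" t s] one.along_diff_le_dist[of ?c s t]
      by (simp add: dist_commute)
    also have "\<dots> \<le> l - \<eta>" using \<eta>(2)[of s t] st by simp
    finally show False using kl \<eta>(1) by simp
  qed
  then show thesis using that[OF \<epsilon>(1)] by blast
qed

lemma swap: "unit_speed_loop_pair l r2 \<theta>2 r1 \<theta>1" ..

lemma turning_gap:
  obtains \<epsilon> where "0 < \<epsilon>"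
    "\<And>s t. 0 \<le> s \<Longrightarrow> s < l \<Longrightarrow> 0 \<le> t \<Longrightarrow> t < l \<Longrightarrow> (\<theta>1 t - \<theta>2 t) - (\<theta>1 s - \<theta>2 s) \<le> 2 * pi - \<epsilon>"
proof -
  obtain e1 where e1: "0 < e1"
    "\<And>s t. 0 \<le> s \<Longrightarrow> s \<le> t \<Longrightarrow> t < l \<Longrightarrow> (\<theta>1 t - \<theta>1 s) - (\<theta>2 t - \<theta>2 s) \<le> 2 * pi - e1"
    using turning_gap_one_sided by blast
  obtain e2 where e2: "0 < e2"
    "\<And>s t. 0 \<le> s \<Longrightarrow> s \<le> t \<Longrightarrow> t < l \<Longrightarrow> (\<theta>2 t - \<theta>2 s) - (\<theta>1 t - \<theta>1 s) \<le> 2 * pi - e2"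
    using unit_speed_loop_pair.turning_gap_one_sided[OF swap] by blast
  have "(\<theta>1 t - \<theta>2 t) - (\<theta>1 s - \<theta>2 s) \<le> 2 * pi - min e1 e2"
    if "0 \<le> s" "s < l" "0 \<le> t" "t < l" for s t
    using e1(2)[of s t] e2(2)[of t s] that by (cases "s \<le> t") auto
  then show thesis using that[of "min e1 e2"] e1(1) e2(1) by simp
qed

text \<open>
  The differences \<open>\<theta>1 s - \<theta>2 s\<close> fill less than one full turn, so a rotation of the first curve centres
  them around \<open>0\<close>.
\<close>

lemma angle_difference_below_pi:
  obtains \<alpha> where "\<And>s. 0 \<le> s \<Longrightarrow> s < l \<Longrightarrow> \<bar>\<theta>1 s + \<alpha> - \<theta>2 s\<bar> < pi"
proof -
  obtain \<epsilon> where \<epsilon>: "0 < \<epsilon>"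
    "\<And>s t. 0 \<le> s \<Longrightarrow> s < l \<Longrightarrow> 0 \<le> t \<Longrightarrow> t < l \<Longrightarrow> (\<theta>1 t - \<theta>2 t) - (\<theta>1 s - \<theta>2 s) \<le> 2 * pi - \<epsilon>"
    using turning_gap by blast
  define D where "D = (\<lambda>s. \<theta>1 s - \<theta>2 s) ` {0..<l}"
  have ne: "D \<noteq> {}" using one.l_pos by (auto simp: D_def)
  have bdd: "bdd_above D"
    unfolding D_def bdd_above_def
    by (rule exI[of _ "\<theta>1 0 - \<theta>2 0 + (2 * pi - \<epsilon>)"]) (use \<epsilon>(2)[of 0] one.l_pos in force)
  \<comment> \<open>the rotation leaves half of the gap \<open>\<epsilon>\<close> free at either end of \<open>(-pi, pi)\<close>\<close>
  have "\<bar>\<theta>1 s + (pi - \<epsilon> / 2 - Sup D) - \<theta>2 s\<bar> < pi" if s: "0 \<le> s" "s < l" for s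
  proof -
    have "\<theta>1 s - \<theta>2 s \<le> Sup D" by (rule cSup_upper[OF _ bdd]) (use s in \<open>auto simp: D_def\<close>)
    moreover have "Sup D \<le> \<theta>1 s - \<theta>2 s + (2 * pi - \<epsilon>)"
      by (rule cSup_least[OF ne]) (use s \<epsilon>(2)[of s] in \<open>force simp: D_def\<close>)
    ultimately show ?thesis using \<epsilon>(1) by linarith
  qed
  then show thesis using that by blast
qed

text \<open>
  Since both curves have unit speed, the tangent of the sum bisects the two tangents. Its angle
  \<open>(\<theta>1 + \<alpha> + \<theta>2) / 2\<close> is monotone with total at most \<open>2 * pi\<close>, and its length
  \<open>2 * cos ((\<theta>1 + \<alpha> - \<theta>2) / 2)\<close> is positive by the choice of \<open>\<alpha>\<close>. A reversal of the sum is a jump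
  of the mean of the two angles by \<open>pi\<close>, so one of the two jumps by at least \<open>pi\<close>, and neither
  by \<open>2 * pi\<close>, as their difference stays in \<open>(-pi, pi)\<close>; \<open>no_sharp_corner\<close> excludes this.
\<close>

theorem rotated_sum_is_convex_loop:
  obtains \<alpha> \<phi> where "inj_on (\<lambda>x. cis \<alpha> * r1 x + r2 x) {0..<l}"
    and "turning_loop l (\<lambda>x. cis \<alpha> * r1 x + r2 x) (\<lambda>x. 2 * cos ((\<theta>1 x + \<alpha> - \<theta>2 x) / 2)) \<phi>"
proof -
  obtain \<alpha> where \<alpha>: "\<And>s. 0 \<le> s \<Longrightarrow> s < l \<Longrightarrow> \<bar>\<theta>1 s + \<alpha> - \<theta>2 s\<bar> < pi"
    using angle_difference_below_pi by blast
  define R where "R = (\<lambda>x. cis \<alpha> * r1 x + r2 x)"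
  define \<rho> where "\<rho> = (\<lambda>x. 2 * cos ((\<theta>1 x + \<alpha> - \<theta>2 x) / 2))"
  define \<phi> where "\<phi> = (\<lambda>x. (\<theta>1 x + \<alpha> + \<theta>2 x) / 2)"
  interpret sum: turning_loop l R \<rho> \<phi>
  proof
    show "0 < l" by (rule one.l_pos)
    show "continuous_on {0..l} R"
      unfolding R_def by (intro continuous_intros one.cont two.cont)
    show "R l = R 0" by (simp add: R_def one.closed two.closed)
    show "\<phi> x \<le> \<phi> y" if "0 \<le> x" "x \<le> y" "y < l" for x y
      using one.\<phi>_mono[OF that] two.\<phi>_mono[OF that] by (simp add: \<phi>_def)
    fix x assume x: "0 \<le> x" "x < l"
    show "\<phi> x \<le> \<phi> 0 + 2 * pi"
      using one.\<phi>_total[OF x] two.\<phi>_total[OF x] by (simp add: \<phi>_def field_simps)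
    show "0 < \<rho> x" unfolding \<rho>_def using \<alpha>[OF x] by (intro mult_pos_pos cos_gt_zero_pi) auto
    have "cis \<alpha> * cis (\<theta>1 x) + cis (\<theta>2 x) = \<rho> x *\<^sub>R cis (\<phi> x)"
      using cis_sum[of "\<theta>1 x + \<alpha>" "\<theta>2 x"] by (simp add: \<rho>_def \<phi>_def cis_mult add.commute)
    moreover have "(R has_vector_derivative cis \<alpha> * cis (\<theta>1 x) + cis (\<theta>2 x)) (at_right x)"
      unfolding R_def using one.tangent[OF x] two.tangent[OF x]
      by (intro has_vector_derivative_add has_vector_derivative_mult_right) auto
    ultimately show "(R has_vector_derivative \<rho> x *\<^sub>R cis (\<phi> x)) (at_right x)" by simp
  qed
  have "\<not> sum.reversal"
  proof
    assume sum.reversal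
    then obtain p a q c where pq: "0 \<le> p" "p < a" "a < q" "q \<le> l"
      and before: "\<And>x. p < x \<Longrightarrow> x < a \<Longrightarrow> \<phi> x = c"
      and after: "\<And>x. a < x \<Longrightarrow> x < q \<Longrightarrow> \<phi> x = c + pi"
      unfolding sum.reversal_def by blast
    have const: "\<theta>1 x = \<theta>1 y \<and> \<theta>2 x = \<theta>2 y"
      if "0 \<le> x" "x < l" "0 \<le> y" "y < l" "\<phi> x = \<phi> y" for x y
    proof -
      have *: "\<theta>1 x + \<theta>2 x = \<theta>1 y + \<theta>2 y" using that by (simp add: \<phi>_def)
      show ?thesis
        using one.\<phi>_mono[of x y] two.\<phi>_mono[of x y] one.\<phi>_mono[of y x] two.\<phi>_mono[of y x] * that
        by (cases "x \<le> y") auto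
    qed
    define x0 y0 where "x0 = (p + a) / 2" and "y0 = (a + q) / 2"
    have x0: "p < x0" "x0 < a" and y0: "a < y0" "y0 < q" using pq by (auto simp: x0_def y0_def)
    define d1 d2 where "d1 = \<theta>1 y0 - \<theta>1 x0" and "d2 = \<theta>2 y0 - \<theta>2 x0"
    have b: "\<theta>1 x = \<theta>1 x0" "\<theta>2 x = \<theta>2 x0" if "p < x" "x < a" for x
      using const[of x x0] before[of x] before[of x0] that x0 pq by auto
    have a: "\<theta>1 x = \<theta>1 x0 + d1" "\<theta>2 x = \<theta>2 x0 + d2" if "a < x" "x < q" for x
      using const[of x y0] after[of x] after[of y0] that y0 pq by (auto simp: d1_def d2_def)
    have "d1 + d2 = 2 * pi"
      using before[OF x0] after[OF y0] by (simp add: d1_def d2_def \<phi>_def)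
    moreover have "\<bar>d1 - d2\<bar> < 2 * pi"
      using \<alpha>[of x0] \<alpha>[of y0] x0 y0 pq by (simp add: d1_def d2_def)
    ultimately have "d1 < 2 * pi" "d2 < 2 * pi" "pi \<le> d1 \<or> pi \<le> d2" by linarith+
    then show False
      using one.no_sharp_corner[of p a q "\<theta>1 x0" d1] two.no_sharp_corner[of p a q "\<theta>2 x0" d2]
        pq a b by blast
  qed
  then have "inj_on R {0..<l}" by (rule sum.injective_unless_reversal)
  then show thesis
    using that sum.turning_loop_axioms unfolding R_def \<rho>_def by blast
qed

end

section \<open>Curves with supporting lines\<close>

text \<open>
  The supporting lines put the curve into the boundary of its convex hull \<open>K\<close>. That \<open>K\<close> has interior
  points follows from the Jordan curve theorem, because the inside of the curve is a nonempty open
  subset of \<open>K\<close>. The curve exhausts the boundary of \<open>K\<close>, since otherwise its complement would be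
  connected; hence its inside is the interior of \<open>K\<close>.
\<close>

lemma supporting_lines_imp_simple_closed_convex_curve:
  assumes path: "path g" and loop: "pathfinish g = pathstart g" and inj: "inj_on g {0..<1}"
    and supp: "\<And>s. s \<in> {0..1} \<Longrightarrow> \<exists>n. n \<noteq> 0 \<and> (\<forall>x\<in>{0..1}. inner n (g s) \<le> inner n (g x))"
  shows "simple_closed_convex_curve g"
proof -
  have end1: "g 1 = g 0" using loop by (simp add: pathfinish_def pathstart_def)
  have "x = y \<or> x = 0 \<and> y = 1 \<or> x = 1 \<and> y = 0"
    if xy: "x \<in> {0..1}" "y \<in> {0..1}" "g x = g y" for x y
  proof -
    consider "x = 1" "y = 1" | "x = 1" "y \<in> {0..<1}" | "x \<in> {0..<1}" "y = 1"
      | "x \<in> {0..<1}" "y \<in> {0..<1}"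
      using xy(1,2) by force
    then show ?thesis
    proof cases
      case 2
      then have "g 0 = g y" using xy(3) end1 by simp
      then have "0 = y" by (rule inj_onD[OF inj]) (use 2 in auto)
      then show ?thesis using 2 by simp
    next
      case 3
      then have "g x = g 0" using xy(3) end1 by simp
      then have "x = 0" by (rule inj_onD[OF inj]) (use 3 in auto)
      then show ?thesis using 3 by simp
    next
      case 4
      then show ?thesis using inj_onD[OF inj xy(3)] by blast
    qed simp
  qed
  then have simple: "simple_path g"
    using path unfolding simple_path_def loop_free_def by blast
  define J where "J = path_image g"
  define K where "K = convex hull J"
  have cJ: "compact J" unfolding J_def by (rule compact_path_image[OF path])
  have K: "compact K" "convex K" "J \<subseteq> K"
    unfolding K_def by (auto simp: cJ compact_convex_hull convex_convex_hull hull_subset)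
  have Kcl: "closed K" using K(1) by (rule compact_imp_closed)
  have J_frontier: "J \<subseteq> frontier K"
  proof
    fix z assume z: "z \<in> J"
    then obtain s where s: "s \<in> {0..1}" "z = g s" by (auto simp: J_def path_image_def)
    obtain n where n: "n \<noteq> 0" "\<forall>x\<in>{0..1}. inner n (g s) \<le> inner n (g x)"
      using supp[OF s(1)] by blast
    have sub: "K \<subseteq> {w. inner n w \<ge> inner n z}"
      unfolding K_def
    proof (rule hull_minimal)
      show "J \<subseteq> {w. inner n w \<ge> inner n z}"
        using n(2) s(2) by (auto simp: J_def path_image_def)
      show "convex {w. inner n w \<ge> inner n z}" by (rule convex_halfspace_ge)
    qed
    have "z \<notin> interior K"
    proof
      assume "z \<in> interior K"
      then obtain e where e: "e > 0" "cball z e \<subseteq> K" by (meson mem_interior_cball)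
      have "z - (e / norm n) *\<^sub>R n \<in> cball z e" using e(1) n(1) by (simp add: dist_norm)
      then have "inner n z \<le> inner n (z - (e / norm n) *\<^sub>R n)" using e(2) sub by blast
      then have "(e / norm n) * inner n n \<le> 0" by (simp add: inner_diff_right)
      moreover have "(e / norm n) * inner n n > 0" using e(1) n(1) by simp
      ultimately show False by simp
    qed
    then show "z \<in> frontier K" using z K(3) Kcl by (auto simp: frontier_def)
  qed
  have inK: "interior K \<noteq> {}"
  proof -
    have "inside J \<subseteq> K"
      using outside_subset_convex[OF K(2,3)] by (auto simp: inside_outside)
    moreover have "open (inside J)" by (rule open_inside) (rule compact_imp_closed[OF cJ])
    moreover have "inside J \<noteq> {}" using Jordan_inside_outside[OF simple loop] by (simp add: J_def)
    ultimately show ?thesis using interior_maximal by blast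
  qed
  have "frontier K \<subseteq> J"
  proof
    fix p assume p: "p \<in> frontier K"
    show "p \<in> J"
    proof (rule ccontr)
      assume "p \<notin> J"
      \<comment> \<open>through a gap of \<open>J\<close> at \<open>p\<close> the interior and the exterior of \<open>K\<close> would be joined\<close>
      then obtain e where e: "e > 0" "ball p e \<subseteq> - J"
        using compact_imp_closed[OF cJ] by (meson ComplI open_Compl open_contains_ball)
      have fcl: "frontier K \<subseteq> closure (interior K)"
        using convex_closure_interior[OF K(2) inK] Kcl by (auto simp: frontier_def)
      obtain y where "y \<in> interior K" "dist y p < e"
        using fcl p e(1) by (metis closure_approachable subsetD)
      then have "y \<in> ball p e \<inter> interior K" by (simp add: dist_commute)
      then have "ball p e \<inter> interior K \<noteq> {}" by blast
      moreover have "ball p e \<inter> - K \<noteq> {}"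
        using p e(1) by (auto simp: frontier_straddle Int_def) 
      moreover have "connected (- K)"
        by (rule connected_complement_bounded_convex[OF compact_imp_bounded[OF K(1)] K(2)]) simp
      moreover have "connected (interior K)" by (rule convex_connected[OF convex_interior[OF K(2)]])
      ultimately have "connected ((interior K \<union> ball p e) \<union> - K)"
        by (intro connected_Un) (auto simp: Int_commute)
      moreover have "(interior K \<union> ball p e) \<union> - K \<subseteq> - J"
        using e(2) J_frontier K(3) by (auto simp: frontier_def)
      moreover have "- J \<subseteq> closure ((interior K \<union> ball p e) \<union> - K)"
      proof
        fix x
        consider "x \<in> closure (interior K)" | "x \<in> - K"
          using fcl closure_subset[of "interior K"] Kcl by (auto simp: frontier_def)
        then show "x \<in> closure ((interior K \<union> ball p e) \<union> - K)"
        proof cases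
          case 1
          have "interior K \<subseteq> (interior K \<union> ball p e) \<union> - K" by auto
          from closure_mono[OF this] 1 show ?thesis by (rule subsetD)
        next
          case 2
          then have "x \<in> (interior K \<union> ball p e) \<union> - K" by simp
          then show ?thesis by (rule subsetD[OF closure_subset])
        qed
      qed
      ultimately have "connected (- J)" by (rule connected_intermediate_closure)
      then show False using Jordan_disconnected[OF simple loop] by (simp add: J_def)
    qed
  qed
  then have "J = frontier K" using J_frontier by blast
  then have "inside J = interior K"
    using inside_frontier_eq_interior[OF compact_imp_bounded[OF K(1)] K(2)] by simp
  then show ?thesis
    using simple loop convex_interior[OF K(2)] by (simp add: simple_closed_convex_curve_def J_def)
qed

section \<open>Arc length\<close>

text \<open>
  The length is the smallest increment \<open>G b - G a\<close> of a function \<open>G\<close> whose increments dominate the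
  chords. Additivity and continuity of the length are obtained from this bound by a suitable choice
  of \<open>G\<close>, with no refinement of subdivisions.
\<close>

lemma curve_length_le:
  assumes ab: "a \<le> b"
    and G: "\<And>x y. a \<le> x \<Longrightarrow> x \<le> y \<Longrightarrow> y \<le> b \<Longrightarrow> dist (\<gamma> x) (\<gamma> y) \<le> G y - G x"
  shows "curve_length \<gamma> a b \<le> ereal (G b - G a)"
  unfolding curve_length_def
proof (rule SUP_least)
  have mono: "G x \<le> G y" if "a \<le> x" "x \<le> y" "y \<le> b" for x y
    using G[OF that] zero_le_dist[of "\<gamma> x" "\<gamma> y"] by linarith
  fix ts assume ts: "ts \<in> {ts. sorted ts \<and> set ts \<subseteq> {a..b}}"
  have mem: "ts ! i \<in> {a..b}" if "i < length ts" for i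
    using ts nth_mem[OF that] by blast
  have "(\<Sum>i<length ts - 1. dist (\<gamma> (ts ! i)) (\<gamma> (ts ! Suc i)))
      \<le> (\<Sum>i<length ts - 1. G (ts ! Suc i) - G (ts ! i))"
  proof (rule sum_mono)
    fix i assume i: "i \<in> {..<length ts - 1}"
    have "ts ! i \<le> ts ! Suc i" using ts i by (auto intro!: sorted_nth_mono)
    then show "dist (\<gamma> (ts ! i)) (\<gamma> (ts ! Suc i)) \<le> G (ts ! Suc i) - G (ts ! i)"
      using mem[of i] mem[of "Suc i"] i by (intro G) auto
  qed
  also have "\<dots> = G (ts ! (length ts - 1)) - G (ts ! 0)"
    by (rule sum_lessThan_telescope)
  also have "\<dots> \<le> G b - G a"
  proof (cases "ts = []")
    case True
    then show ?thesis using mono[of a b] ab by simp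
  next
    case False
    then have "ts ! 0 \<in> {a..b}" "ts ! (length ts - 1) \<in> {a..b}" using mem by auto
    then show ?thesis using mono[of a "ts ! 0"] mono[of "ts ! (length ts - 1)" b] by auto
  qed
  finally show "ereal (\<Sum>i<length ts - 1. dist (\<gamma> (ts ! i)) (\<gamma> (ts ! Suc i))) \<le> ereal (G b - G a)"
    by simp
qed

lemma curve_length_extend:
  assumes "a \<le> x" "x \<le> y"
  shows "curve_length \<gamma> a x + ereal (dist (\<gamma> x) (\<gamma> y)) \<le> curve_length \<gamma> a y"
proof -
  let ?d = "\<lambda>ts i. dist (\<gamma> (ts ! i)) (\<gamma> (ts ! Suc i))"
  have "curve_length \<gamma> a x \<le> curve_length \<gamma> a y - ereal (dist (\<gamma> x) (\<gamma> y))"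
    unfolding curve_length_def[of \<gamma> a x]
  proof (rule SUP_least)
    fix ts assume ts: "ts \<in> {ts. sorted ts \<and> set ts \<subseteq> {a..x}}"
    define us where "us = ts @ [x, y]"
    have us: "us \<in> {ts. sorted ts \<and> set ts \<subseteq> {a..y}}"
      using ts assms by (auto simp: us_def sorted_append)
    have "(\<Sum>i<length ts - 1. ?d ts i) = (\<Sum>i<length ts - 1. ?d us i)"
      by (rule sum.cong) (auto simp: us_def nth_append)
    also have "\<dots> \<le> (\<Sum>i<length ts. ?d us i)" by (rule sum_mono2) auto
    finally have "(\<Sum>i<length ts - 1. ?d ts i) + dist (\<gamma> x) (\<gamma> y) \<le> (\<Sum>i<Suc (length ts). ?d us i)"
      by (simp add: us_def nth_append)
    also have "Suc (length ts) = length us - 1" by (simp add: us_def)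
    finally have "ereal ((\<Sum>i<length ts - 1. ?d ts i) + dist (\<gamma> x) (\<gamma> y)) \<le> ereal (\<Sum>i<length us - 1. ?d us i)"
      by (simp only: ereal_less_eq)
    also have "\<dots> \<le> curve_length \<gamma> a y"
      unfolding curve_length_def by (rule SUP_upper) (rule us)
    finally show "ereal (\<Sum>i<length ts - 1. ?d ts i) \<le> curve_length \<gamma> a y - ereal (dist (\<gamma> x) (\<gamma> y))"
      by (simp add: ereal_le_minus)
  qed
  then show ?thesis by (simp add: ereal_le_minus)
qed

text \<open>
  Here \<open>\<tau>\<close> is the inverse of the length function \<open>L\<close>. The last two clauses say that \<open>\<gamma> \<circ> \<tau>\<close> has length
  \<open>b - a\<close> on \<open>{a..b}\<close>: the identity dominates the chords, and no dominating function grows less.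

  That \<open>L\<close> attains every value in \<open>{0..l}\<close> is seen by removing jumps: if \<open>L\<close> skipped a value \<open>s\<close>, say at
  \<open>x\<close>, then by continuity of \<open>\<gamma>\<close> the function \<open>L\<close> with the part of its jump on one side of \<open>s\<close>
  cut out would still dominate all chords, contradicting minimality.
\<close>

theorem arc_length_parametrization:
  assumes simple: "simple_path \<gamma>" and len: "curve_length \<gamma> 0 1 = ereal l"
  obtains \<tau> where "\<tau> ` {0..l} \<subseteq> {0..1}" "strict_mono_on {0..l} \<tau>" "\<tau> 0 = 0" "\<tau> l = 1" "0 < l"
    and "\<And>s. s \<in> {0..l} \<Longrightarrow> curve_length \<gamma> 0 (\<tau> s) = ereal s"
    and "\<And>s t. t \<in> {0..1} \<Longrightarrow> curve_length \<gamma> 0 t = ereal s \<Longrightarrow> s \<in> {0..l} \<and> t = \<tau> s"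
    and "\<And>x y. 0 \<le> x \<Longrightarrow> x \<le> y \<Longrightarrow> y \<le> l \<Longrightarrow> dist (\<gamma> (\<tau> x)) (\<gamma> (\<tau> y)) \<le> y - x"
    and "\<And>a b G. 0 \<le> a \<Longrightarrow> a \<le> b \<Longrightarrow> b \<le> l \<Longrightarrow>
      (\<And>x y. a \<le> x \<Longrightarrow> x \<le> y \<Longrightarrow> y \<le> b \<Longrightarrow> dist (\<gamma> (\<tau> x)) (\<gamma> (\<tau> y)) \<le> G y - G x)
      \<Longrightarrow> b - a \<le> G b - G a"
proof -
  have cont: "continuous_on {0..1} \<gamma>"
    using simple_path_imp_path[OF simple] by (simp add: path_def)
  define L where "L t = real_of_ereal (curve_length \<gamma> 0 t)" for t
  have L: "curve_length \<gamma> 0 t = ereal (L t)" if t: "0 \<le> t" "t \<le> 1" for t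
  proof -
    have "curve_length \<gamma> 0 t + ereal (dist (\<gamma> t) (\<gamma> 1)) \<le> ereal l"
      using curve_length_extend[of 0 t 1 \<gamma>] t len by simp
    moreover have "0 \<le> curve_length \<gamma> 0 t"
      unfolding curve_length_def by (rule SUP_upper2[of "[]"]) auto
    ultimately have "\<bar>curve_length \<gamma> 0 t\<bar> \<noteq> \<infinity>"
      by (cases "curve_length \<gamma> 0 t") auto
    then show ?thesis by (simp add: L_def ereal_real)
  qed
  have L0: "L 0 = 0"
  proof -
    have "curve_length \<gamma> 0 0 \<le> ereal (0 - 0)"
    proof (rule curve_length_le[where G = "\<lambda>x. x"])
      fix x y :: real assume "0 \<le> x" "x \<le> y" "y \<le> 0"
      then have "x = 0" "y = 0" by auto
      then show "dist (\<gamma> x) (\<gamma> y) \<le> y - x" by simp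
    qed simp
    moreover have "0 \<le> curve_length \<gamma> 0 0"
      unfolding curve_length_def by (rule SUP_upper2[of "[]"]) auto
    ultimately show ?thesis using L[of 0] by simp
  qed
  have dist_le: "dist (\<gamma> x) (\<gamma> y) \<le> L y - L x" if "0 \<le> x" "x \<le> y" "y \<le> 1" for x y
    using curve_length_extend[of 0 x y \<gamma>] L[of x] L[of y] that by simp
  have minimal: "L y - L x \<le> G y - G x"
    if xy: "0 \<le> x" "x \<le> y" "y \<le> 1"
      and G: "\<And>u v. x \<le> u \<Longrightarrow> u \<le> v \<Longrightarrow> v \<le> y \<Longrightarrow> dist (\<gamma> u) (\<gamma> v) \<le> G v - G u" for x y G
  proof -
    \<comment> \<open>following \<open>L\<close> up to \<open>x\<close> and \<open>G\<close> from there on dominates all chords in \<open>{0..y}\<close>\<close>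
    define H where "H u = (if u \<le> x then L u else L x + G u - G x)" for u
    have "curve_length \<gamma> 0 y \<le> ereal (H y - H 0)"
    proof (rule curve_length_le)
      fix u v assume uv: "0 \<le> u" "u \<le> v" "v \<le> y"
      consider "v \<le> x" | "u \<le> x" "x < v" | "x < u" using uv by linarith
      then show "dist (\<gamma> u) (\<gamma> v) \<le> H v - H u"
      proof cases
        case 1
        then show ?thesis using uv xy dist_le[of u v] by (simp add: H_def)
      next
        case 2
        have "dist (\<gamma> u) (\<gamma> v) \<le> dist (\<gamma> u) (\<gamma> x) + dist (\<gamma> x) (\<gamma> v)" by (rule dist_triangle)
        then show ?thesis using 2 uv xy dist_le[of u x] G[of x v] by (simp add: H_def)
      next
        case 3
        then show ?thesis using uv G[of u v] by (simp add: H_def)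
      qed
    qed (use xy in auto)
    then have "L y \<le> H y" using L[of y] L0 xy by (simp add: H_def)
    then show ?thesis by (cases "y = x") (use xy in \<open>auto simp: H_def\<close>)
  qed
  have L1: "L 1 = l" using L[of 1] len by simp
  have L_less: "L x < L y" if xy: "0 \<le> x" "x < y" "y \<le> 1" for x y
  proof -
    define m where "m = (x + y) / 2"
    have m: "x < m" "m < y" using xy by (auto simp: m_def)
    have "\<gamma> x \<noteq> \<gamma> m"
      using simple m xy by (force simp: simple_path_def loop_free_def)
    then have "0 < L m - L x" using dist_le[of x m] m xy zero_less_dist_iff[of "\<gamma> x" "\<gamma> m"] by linarith
    also have "L m \<le> L y" using dist_le[of m y] m xy zero_le_dist[of "\<gamma> m" "\<gamma> y"] by linarith
    finally show ?thesis by simp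
  qed
  have L_le: "L x \<le> L y" if "0 \<le> x" "x \<le> y" "y \<le> 1" for x y
    using L_less[of x y] that by (cases "x = y") auto
  \<comment> \<open>a chord bound that holds up to the distance from \<open>\<gamma> x\<close> to points arbitrarily near it\<close>
  have close: "dist (\<gamma> u) (\<gamma> v) \<le> k"
    if ends: "0 \<le> c" "c < d" "d \<le> 1" and x: "x \<in> {c, d}"
      and step: "\<And>w. c < w \<Longrightarrow> w < d \<Longrightarrow> dist (\<gamma> u) (\<gamma> v) \<le> k + dist (\<gamma> x) (\<gamma> w)" for u v c d x k
  proof (rule field_le_epsilon)
    fix e :: real assume e: "e > 0"
    have "x \<in> {0..1}" using ends x by auto
    then obtain \<delta> where \<delta>: "\<delta> > 0" "\<And>w. w \<in> {0..1} \<Longrightarrow> dist w x < \<delta> \<Longrightarrow> dist (\<gamma> w) (\<gamma> x) < e"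
      using cont e unfolding continuous_on_iff by blast
    obtain w where w: "c < w" "w < d" "dist w x < \<delta>"
    proof (cases "x = c")
      case True
      have "c < min d (c + \<delta>)" using ends \<delta> by simp
      then obtain w where "c < w" "w < min d (c + \<delta>)" using dense by blast
      then show thesis using that[of w] True by (simp add: dist_real_def)
    next
      case False
      have "max c (d - \<delta>) < d" using ends \<delta> by simp
      then obtain w where "max c (d - \<delta>) < w" "w < d" using dense by blast
      then show thesis using that[of w] False x by (simp add: dist_real_def)
    qed
    have "dist (\<gamma> x) (\<gamma> w) < e" using \<delta>(2)[of w] w ends by (simp add: dist_commute)
    then show "dist (\<gamma> u) (\<gamma> v) \<le> k + e" using step[OF w(1,2)] by simp
  qed
  have surj: "\<exists>t\<in>{0..1}. L t = s" if s: "s \<in> {0..l}" for s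
  proof (rule ccontr)
    assume no: "\<not> (\<exists>t\<in>{0..1}. L t = s)"
    define S where "S = {t. 0 \<le> t \<and> t \<le> 1 \<and> L t \<le> s}"
    define x where "x = Sup S"
    have S0: "0 \<in> S" using s L0 by (simp add: S_def)
    have bdd: "bdd_above S" by (auto simp: S_def bdd_above_def intro!: exI[of _ 1])
    have x01: "0 \<le> x" "x \<le> 1"
    proof -
      show "0 \<le> x" unfolding x_def by (rule cSup_upper[OF S0 bdd])
      have "S \<noteq> {}" using S0 by blast
      then show "x \<le> 1" unfolding x_def by (rule cSup_least) (simp add: S_def)
    qed
    have below: "L t < s" if t: "0 \<le> t" "t < x" for t
    proof -
      obtain y where y: "y \<in> S" "t < y" using t less_cSup_iff[of S t] S0 bdd by (auto simp: x_def)
      then show ?thesis using L_less[of t y] t by (auto simp: S_def)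
    qed
    have above: "s < L t" if t: "x < t" "t \<le> 1" for t
    proof -
      have "t \<notin> S" using cSup_upper[OF _ bdd, of t] t by (auto simp: x_def)
      then show ?thesis using t x01 by (auto simp: S_def)
    qed
    have "L x \<noteq> s" using no x01 by auto
    then consider "L x < s" | "s < L x" by linarith
    then show False
    proof cases
      case 1
      define e where "e = s - L x"
      define G where "G u = (if u \<le> x then L u else L u - e)" for u
      have "x < 1" using 1 s L1 x01 by (cases "x = 1") auto
      have "L 1 - L 0 \<le> G 1 - G 0"
      proof (rule minimal)
        fix u v :: real assume uv: "0 \<le> u" "u \<le> v" "v \<le> 1"
        show "dist (\<gamma> u) (\<gamma> v) \<le> G v - G u"
        proof (cases "u \<le> x \<and> x < v")
          case True
          show ?thesis
          proof (rule close[of x v x])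
            fix w assume w: "x < w" "w < v"
            have "dist (\<gamma> u) (\<gamma> v) \<le> dist (\<gamma> u) (\<gamma> x) + dist (\<gamma> x) (\<gamma> w) + dist (\<gamma> w) (\<gamma> v)"
              using dist_triangle[of "\<gamma> u" "\<gamma> v" "\<gamma> x"] dist_triangle[of "\<gamma> x" "\<gamma> v" "\<gamma> w"] by linarith
            then show "dist (\<gamma> u) (\<gamma> v) \<le> G v - G u + dist (\<gamma> x) (\<gamma> w)"
              using dist_le[of u x] dist_le[of w v] above[of w] True uv x01 w by (simp add: G_def e_def)
          qed (use True uv x01 in auto)
        next
          case False
          then show ?thesis using dist_le[of u v] uv by (auto simp: G_def)
        qed
      qed auto
      then show False using \<open>x < 1\<close> x01 1 by (simp add: G_def e_def)
    next
      case 2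
      define e where "e = L x - s"
      define G where "G u = (if u < x then L u else L u - e)" for u
      have "0 < x" using 2 s L0 x01 by (cases "x = 0") auto
      have "L 1 - L 0 \<le> G 1 - G 0"
      proof (rule minimal)
        fix u v :: real assume uv: "0 \<le> u" "u \<le> v" "v \<le> 1"
        show "dist (\<gamma> u) (\<gamma> v) \<le> G v - G u"
        proof (cases "u < x \<and> x \<le> v")
          case True
          show ?thesis
          proof (rule close[of u x x])
            fix w assume w: "u < w" "w < x"
            have "dist (\<gamma> u) (\<gamma> v) \<le> dist (\<gamma> u) (\<gamma> w) + dist (\<gamma> x) (\<gamma> w) + dist (\<gamma> x) (\<gamma> v)"
              using dist_triangle[of "\<gamma> u" "\<gamma> v" "\<gamma> w"] dist_triangle[of "\<gamma> w" "\<gamma> v" "\<gamma> x"]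
              by (simp add: dist_commute)
            then show "dist (\<gamma> u) (\<gamma> v) \<le> G v - G u + dist (\<gamma> x) (\<gamma> w)"
              using dist_le[of u w] dist_le[of x v] below[of w] True uv x01 w by (simp add: G_def e_def)
          qed (use True uv x01 in auto)
        next
          case False
          then show ?thesis using dist_le[of u v] uv by (auto simp: G_def)
        qed
      qed auto
      then show False using \<open>0 < x\<close> x01 2 by (simp add: G_def e_def)
    qed
  qed
  then obtain \<tau> where \<tau>: "\<And>s. s \<in> {0..l} \<Longrightarrow> \<tau> s \<in> {0..1} \<and> L (\<tau> s) = s" by metis
  have unique: "t = \<tau> s" if "t \<in> {0..1}" "L t = s" "s \<in> {0..l}" for s t
    using \<tau>[OF that(3)] that L_less[of t "\<tau> s"] L_less[of "\<tau> s" t] by (cases t "\<tau> s" rule: linorder_cases) auto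
  have L_range: "L t \<in> {0..l}" if "t \<in> {0..1}" for t
    using L_le[of 0 t] L_le[of t 1] that L0 L1 by auto
  have \<tau>_less: "\<tau> x < \<tau> y" if "x \<in> {0..l}" "y \<in> {0..l}" "x < y" for x y
    using \<tau>[OF that(1)] \<tau>[OF that(2)] that(3) L_le[of "\<tau> y" "\<tau> x"] by (cases "\<tau> x < \<tau> y") auto
  have \<tau>_le: "\<tau> x \<le> \<tau> y" if "x \<in> {0..l}" "y \<in> {0..l}" "x \<le> y" for x y
    using \<tau>_less[of x y] that by (cases "x = y") auto
  have l: "0 < l" using L_less[of 0 1] L0 L1 by simp
  show thesis
  proof
    show "\<tau> ` {0..l} \<subseteq> {0..1}" using \<tau> by auto
    show "strict_mono_on {0..l} \<tau>" using \<tau>_less by (simp add: strict_mono_on_def)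
    show "\<tau> 0 = 0" using unique[of 0 0] L0 l by simp
    show "\<tau> l = 1" using unique[of 1 l] L1 l by simp
    show "0 < l" by (rule l)
    show "curve_length \<gamma> 0 (\<tau> s) = ereal s" if "s \<in> {0..l}" for s
      using L[of "\<tau> s"] \<tau>[OF that] by simp
    show "s \<in> {0..l} \<and> t = \<tau> s" if "t \<in> {0..1}" "curve_length \<gamma> 0 t = ereal s" for s t
      using L[of t] that L_range[of t] unique[of t s] by auto
    show "dist (\<gamma> (\<tau> x)) (\<gamma> (\<tau> y)) \<le> y - x" if "0 \<le> x" "x \<le> y" "y \<le> l" for x y
      using dist_le[of "\<tau> x" "\<tau> y"] \<tau>[of x] \<tau>[of y] \<tau>_le[of x y] that by auto
    show "b - a \<le> G b - G a"
      if ab: "0 \<le> a" "a \<le> b" "b \<le> l"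
        and G: "\<And>x y. a \<le> x \<Longrightarrow> x \<le> y \<Longrightarrow> y \<le> b \<Longrightarrow> dist (\<gamma> (\<tau> x)) (\<gamma> (\<tau> y)) \<le> G y - G x" for a b G
    proof -
      have in_ab: "L u \<in> {a..b} \<and> \<tau> (L u) = u" if "\<tau> a \<le> u" "u \<le> \<tau> b" for u
      proof -
        have u: "u \<in> {0..1}" using that \<tau>[of a] \<tau>[of b] ab by auto
        have "L (\<tau> a) \<le> L u" "L u \<le> L (\<tau> b)"
          using L_le[of "\<tau> a" u] L_le[of u "\<tau> b"] that u \<tau>[of a] \<tau>[of b] ab by auto
        then show ?thesis using \<tau>[of a] \<tau>[of b] ab unique[of u "L u"] u L_range[OF u] by auto
      qed
      have "L (\<tau> b) - L (\<tau> a) \<le> G (L (\<tau> b)) - G (L (\<tau> a))"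
      proof (rule minimal[where G = "\<lambda>u. G (L u)"])
        fix u v assume uv: "\<tau> a \<le> u" "u \<le> v" "v \<le> \<tau> b"
        have "L u \<le> L v" using uv \<tau>[of a] \<tau>[of b] ab by (intro L_le) auto
        then show "dist (\<gamma> u) (\<gamma> v) \<le> G (L v) - G (L u)"
          using G[of "L u" "L v"] in_ab[of u] in_ab[of v] uv by auto
      qed (use \<tau>[of a] \<tau>[of b] \<tau>_le[of a b] ab in auto)
      then show ?thesis using \<tau>[of a] \<tau>[of b] ab by simp
    qed
  qed
qed

section \<open>Orientation of triples on a convex curve\<close>

text \<open>
  The points \<open>P x\<close>, \<open>P y\<close>, \<open>P z\<close> are met in this order going once counterclockwise around \<open>0\<close>. Twice the
  signed area of their triangle is the sum of three such areas with apex \<open>0\<close>, which are nonnegative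
  unless one of the three angular gaps exceeds \<open>pi\<close>. In that case the remaining point lies in the
  sector of angle less than \<open>pi\<close> spanned by the other two, and a negative sum would put it strictly
  on the side of \<open>0\<close> of the segment joining them; \<open>star\<close> forbids this.
\<close>

lemma polar_order_imp_oriented:
  fixes P :: "real \<Rightarrow> complex" and \<rho> \<psi> :: "real \<Rightarrow> real"
  assumes polar: "\<And>t. t \<in> {0..1} \<Longrightarrow> P t = \<rho> t *\<^sub>R cis (\<psi> t)" "\<And>t. t \<in> {0..1} \<Longrightarrow> 0 < \<rho> t"
    and mono: "strict_mono_on {0..1} \<psi>" and total: "\<psi> 1 = \<psi> 0 + 2 * pi"
    and star: "\<And>t x y a b. t \<in> {0..1} \<Longrightarrow> x \<in> {0..1} \<Longrightarrow> y \<in> {0..1} \<Longrightarrow>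
      0 \<le> a \<Longrightarrow> 0 \<le> b \<Longrightarrow> a + b < 1 \<Longrightarrow> P t \<noteq> a *\<^sub>R P x + b *\<^sub>R P y"
    and xyz: "0 \<le> x" "x < y" "y < z" "z \<le> 1"
  shows "0 \<le> Im ((P z - P y) * cnj (P y - P x))"
proof -
  define D where "D u v = Im (cnj (P u) * P v)" for u v
  have D: "D u v = \<rho> u * \<rho> v * sin (\<psi> v - \<psi> u)" if "u \<in> {0..1}" "v \<in> {0..1}" for u v
    using polar(1)[OF that(1)] polar(1)[OF that(2)] by (simp add: D_def sin_diff algebra_simps)
  have D_nonneg: "0 \<le> D u v" if "u \<in> {0..1}" "v \<in> {0..1}" "0 \<le> sin (\<psi> v - \<psi> u)" for u v
    using D[OF that(1,2)] polar(2)[OF that(1)] polar(2)[OF that(2)] that(3) by simp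
  have D_pos: "0 < D u v" if "u \<in> {0..1}" "v \<in> {0..1}" "0 < sin (\<psi> v - \<psi> u)" for u v
    using D[OF that(1,2)] polar(2)[OF that(1)] polar(2)[OF that(2)] that(3) by simp
  have D_swap: "D u v = - D v u" for u v by (simp add: D_def)
  have sector: "D u w \<le> D u v + D v w"
    if m: "u \<in> {0..1}" "v \<in> {0..1}" "w \<in> {0..1}" and nn: "0 \<le> D u v" "0 \<le> D v w" "0 < D u w" for u v w
  proof (rule ccontr)
    assume "\<not> ?thesis"
    then have lt: "D v w / D u w + D u v / D u w < 1"
      using nn(3) by (simp add: add_divide_distrib[symmetric])
    \<comment> \<open>Cramer's rule expresses \<open>P v\<close> in the basis \<open>P u\<close>, \<open>P w\<close>\<close>
    have "D u w *\<^sub>R P v = D v w *\<^sub>R P u + D u v *\<^sub>R P w"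
      by (simp add: D_def complex_eq_iff algebra_simps)
    then have "P v = (D v w / D u w) *\<^sub>R P u + (D u v / D u w) *\<^sub>R P w"
      using nn(3) by (simp add: complex_eq_iff field_simps)
    then show False
      using star[OF m(2,1,3), of "D v w / D u w" "D u v / D u w"] lt nn by simp
  qed
  have m: "x \<in> {0..1}" "y \<in> {0..1}" "z \<in> {0..1}" using xyz by auto
  have g1: "\<psi> x < \<psi> y" and g2: "\<psi> y < \<psi> z"
    using mono xyz by (auto simp: strict_mono_on_def)
  have g3: "\<psi> z - \<psi> x \<le> 2 * pi"
    using strict_mono_on_leD[OF mono, of 0 x] strict_mono_on_leD[OF mono, of z 1] m total by auto
  have "0 \<le> D x y + D y z + D z x"
  proof -
    consider "\<psi> y - \<psi> x > pi" | "\<psi> z - \<psi> y > pi" | "\<psi> z - \<psi> x < pi"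
      | "\<psi> y - \<psi> x \<le> pi" "\<psi> z - \<psi> y \<le> pi" "\<psi> z - \<psi> x \<ge> pi" by linarith
    then show ?thesis
    proof cases
      case 1
      have "sin (\<psi> x - \<psi> y) = sin (\<psi> x + 2 * pi - \<psi> y)" by (simp add: sin_diff)
      also have "\<dots> > 0" using 1 g1 g2 g3 by (intro sin_gt_zero) auto
      finally have "0 < D y x" using m by (intro D_pos) auto
      moreover have "0 \<le> D y z" using 1 g1 g2 g3 m by (intro D_nonneg sin_ge_zero) auto
      moreover have "sin (\<psi> x - \<psi> z) = sin (\<psi> x + 2 * pi - \<psi> z)" by (simp add: sin_diff)
      then have "0 \<le> D z x" using 1 g1 g2 g3 m by (intro D_nonneg) (auto intro: sin_ge_zero)
      ultimately have "D y x \<le> D y z + D z x" using m by (intro sector) auto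
      then show ?thesis using D_swap[of x y] by simp
    next
      case 2
      have "sin (\<psi> y - \<psi> z) = sin (\<psi> y + 2 * pi - \<psi> z)" by (simp add: sin_diff)
      also have "\<dots> > 0" using 2 g1 g2 g3 by (intro sin_gt_zero) auto
      finally have "0 < D z y" using m by (intro D_pos) auto
      moreover have "0 \<le> D x y" using 2 g1 g2 g3 m by (intro D_nonneg sin_ge_zero) auto
      moreover have "sin (\<psi> x - \<psi> z) = sin (\<psi> x + 2 * pi - \<psi> z)" by (simp add: sin_diff)
      then have "0 \<le> D z x" using 2 g1 g2 g3 m by (intro D_nonneg) (auto intro: sin_ge_zero)
      ultimately have "D z y \<le> D z x + D x y" using m by (intro sector) auto
      then show ?thesis using D_swap[of y z] by simp
    next
      case 3
      then have "0 < D x z" using g1 g2 m by (intro D_pos sin_gt_zero) auto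
      moreover have "0 \<le> D x y" "0 \<le> D y z"
        using 3 g1 g2 m by (auto intro!: D_nonneg sin_ge_zero)
      ultimately have "D x z \<le> D x y + D y z" using m by (intro sector) auto
      then show ?thesis using D_swap[of z x] by simp
    next
      case 4
      have "sin (\<psi> x - \<psi> z) = sin (\<psi> x + 2 * pi - \<psi> z)" by (simp add: sin_diff)
      then have "0 \<le> D z x" using 4 g1 g2 g3 m by (intro D_nonneg) (auto intro: sin_ge_zero)
      moreover have "0 \<le> D x y" "0 \<le> D y z"
        using 4 g1 g2 m by (auto intro!: D_nonneg sin_ge_zero)
      ultimately show ?thesis by simp
    qed
  qed
  also have "D x y + D y z + D z x = Im ((P z - P y) * cnj (P y - P x))"
    by (simp add: D_def algebra_simps)
  finally show ?thesis .
qed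

text \<open>
  Around an inside point \<open>z0\<close> the curve has a continuous polar angle, the imaginary part of a
  logarithm of \<open>\<gamma> - z0\<close>. A ray from \<open>z0\<close> leaves the convex inside at one point only, so the polar angle
  is injective and therefore strictly monotone, and its total change is given by the winding number.
\<close>

lemma convex_curve_oriented:
  assumes conv: "simple_closed_convex_curve \<gamma>" and z0: "z0 \<in> inside (path_image \<gamma>)"
    and wn: "winding_number \<gamma> z0 = of_real \<sigma>" and \<sigma>: "\<sigma> = 1 \<or> \<sigma> = - 1"
    and abc: "0 \<le> a" "a < b" "b < c" "c \<le> 1"
  shows "0 \<le> \<sigma> * Im ((\<gamma> c - \<gamma> b) * cnj (\<gamma> b - \<gamma> a))"
proof -
  have simple: "simple_path \<gamma>" and loop: "pathfinish \<gamma> = pathstart \<gamma>"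
    and U: "convex (inside (path_image \<gamma>))"
    using conv by (auto simp: simple_closed_convex_curve_def)
  define U where "U = inside (path_image \<gamma>)"
  have U: "convex U" "open U" "frontier U = path_image \<gamma>" "z0 \<in> U"
    using U Jordan_inside_outside[OF simple loop] z0 by (auto simp: U_def)
  have cl: "\<gamma> t \<in> closure U" "\<gamma> t \<notin> U" if "t \<in> {0..1}" for t
  proof -
    have "\<gamma> t \<in> frontier U" using that U(3) by (auto simp: path_image_def)
    then show "\<gamma> t \<in> closure U" "\<gamma> t \<notin> U" using U(2) by (auto simp: frontier_def interior_open)
  qed
  have star: "\<gamma> t - z0 \<noteq> u *\<^sub>R (\<gamma> x - z0) + v *\<^sub>R (\<gamma> y - z0)"
    if "t \<in> {0..1}" "x \<in> {0..1}" "y \<in> {0..1}" "0 \<le> u" "0 \<le> v" "u + v < 1" for t x y u v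
  proof
    assume eq: "\<gamma> t - z0 = u *\<^sub>R (\<gamma> x - z0) + v *\<^sub>R (\<gamma> y - z0)"
    show False
    proof (cases "u + v = 0")
      case True
      then have "u = 0" "v = 0" using that by auto
      then have "\<gamma> t = z0" using eq by simp
      then show False using cl(2)[OF that(1)] U(4) by simp
    next
      case False
      define k where "k = u + v"
      have k: "0 < k" "k < 1" using False that by (auto simp: k_def)
      define p where "p = (u / k) *\<^sub>R \<gamma> x + (v / k) *\<^sub>R \<gamma> y"
      have "u / k + v / k = 1" using k by (simp add: k_def add_divide_distrib[symmetric])
      then have p: "p \<in> closure U"
        unfolding p_def using that k cl(1)[OF that(2)] cl(1)[OF that(3)]
        by (intro convexD[OF convex_closure[OF U(1)]]) auto
      have kp: "k *\<^sub>R p = u *\<^sub>R \<gamma> x + v *\<^sub>R \<gamma> y"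
        using k by (simp add: p_def scaleR_add_right)
      have "\<gamma> t = z0 + (u *\<^sub>R (\<gamma> x - z0) + v *\<^sub>R (\<gamma> y - z0))" using eq by (simp add: algebra_simps)
      also have "\<dots> = (1 - k) *\<^sub>R z0 + k *\<^sub>R p"
        unfolding kp by (simp add: k_def algebra_simps)
      finally have t: "\<gamma> t = (1 - k) *\<^sub>R z0 + k *\<^sub>R p" .
      show False
      proof (cases "p = z0")
        case True
        then have "\<gamma> t = z0" using t by (simp add: algebra_simps)
        then show False using cl(2)[OF that(1)] U(4) by simp
      next
        case False
        then have "\<gamma> t \<in> open_segment z0 p" using t k by (auto simp: in_segment)
        then have "\<gamma> t \<in> interior U"
          using in_interior_closure_convex_segment[OF U(1) _ p, of z0] U(2,4) by (auto simp: interior_open)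
        then show False using cl(2)[OF that(1)] U(2) by (simp add: interior_open)
      qed
    qed
  qed
  have "z0 \<notin> path_image \<gamma>" using z0 by (auto simp: inside_def)
  then obtain q where q: "path q"
      "pathfinish q - pathstart q = 2 * of_real pi * \<i> * winding_number \<gamma> z0"
      "\<And>t. t \<in> {0..1} \<Longrightarrow> \<gamma> t = z0 + exp (q t)"
    using winding_number_as_continuous_log[OF simple_path_imp_path[OF simple]] by metis
  define \<psi> where "\<psi> t = Im (q t)" for t
  define \<rho> where "\<rho> t = exp (Re (q t))" for t
  have total: "\<psi> 1 = \<psi> 0 + 2 * pi * \<sigma>"
    using arg_cong[OF q(2), of Im] by (simp add: wn \<psi>_def pathfinish_def pathstart_def)
  have polar: "\<gamma> t - z0 = \<rho> t *\<^sub>R cis (\<psi> t)" if "t \<in> {0..1}" for t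
    using q(3)[OF that] by (simp add: exp_eq_polar \<rho>_def \<psi>_def scaleR_conv_of_real)
  have no_shadow: "\<rho> t \<le> \<rho> s" if st: "s \<in> {0..1}" "t \<in> {0..1}" "\<psi> s = \<psi> t" for s t
  proof (rule ccontr)
    assume "\<not> ?thesis"
    then have "\<rho> s / \<rho> t < 1" by (simp add: \<rho>_def)
    moreover have "\<gamma> s - z0 = (\<rho> s / \<rho> t) *\<^sub>R (\<gamma> t - z0) + 0 *\<^sub>R (\<gamma> t - z0)"
      using st polar by (simp add: \<rho>_def)
    ultimately show False using star[OF st(1,2,2), of "\<rho> s / \<rho> t" 0] by (simp add: \<rho>_def)
  qed
  have "inj_on \<psi> {0..1}"
  proof (rule inj_onI)
    fix s t :: real assume st: "s \<in> {0..1}" "t \<in> {0..1}" "\<psi> s = \<psi> t"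
    then have "\<rho> s = \<rho> t" using no_shadow[of s t] no_shadow[of t s] by simp
    then have "\<gamma> s - z0 = \<gamma> t - z0" using polar[OF st(1)] polar[OF st(2)] st(3) by simp
    then have "s = t \<or> s = 0 \<and> t = 1 \<or> s = 1 \<and> t = 0"
      using simple st by (auto simp: simple_path_def loop_free_def)
    then show "s = t" using st(3) total \<sigma> by auto
  qed
  moreover have c\<psi>: "continuous_on {0..1} \<psi>"
    unfolding \<psi>_def using q(1) by (intro continuous_intros) (simp add: path_def)
  ultimately have mono: "strict_mono_on {0..1} \<psi> \<or> strict_antimono_on {0..1} \<psi>"
    using injective_eq_monotone_map[of "{0..1}" \<psi>] by (simp add: is_interval_cc)
  show ?thesis
    using \<sigma>
  proof
    assume s: "\<sigma> = 1"
    have "\<not> strict_antimono_on {0..1} \<psi>"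
      using total s monotone_onD[of "{0..1}" "(<)" "(>)" \<psi> 0 1] by auto
    then have "strict_mono_on {0..1} \<psi>" using mono by blast
    then have "0 \<le> Im (((\<gamma> c - z0) - (\<gamma> b - z0)) * cnj ((\<gamma> b - z0) - (\<gamma> a - z0)))"
      by (rule polar_order_imp_oriented[rotated 2])
        (use polar star abc total s in \<open>auto simp: \<rho>_def\<close>)
    then show ?thesis using s by simp
  next
    assume s: "\<sigma> = - 1"
    have "\<not> strict_mono_on {0..1} \<psi>"
      using total s monotone_onD[of "{0..1}" "(<)" "(<)" \<psi> 0 1] by auto
    then have "strict_antimono_on {0..1} \<psi>" using mono by blast
    then have m: "strict_mono_on {0..1} (\<lambda>t. - \<psi> t)" by (simp add: monotone_on_def)
    have "0 \<le> Im ((cnj (\<gamma> c - z0) - cnj (\<gamma> b - z0)) * cnj (cnj (\<gamma> b - z0) - cnj (\<gamma> a - z0)))"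
    proof (rule polar_order_imp_oriented[where P = "\<lambda>t. cnj (\<gamma> t - z0)", OF _ _ m])
      show "cnj (\<gamma> t - z0) = \<rho> t *\<^sub>R cis (- \<psi> t)" if "t \<in> {0..1}" for t
        using polar[OF that] by (simp add: complex_eq_iff)
      show "cnj (\<gamma> t - z0) \<noteq> u *\<^sub>R cnj (\<gamma> x - z0) + v *\<^sub>R cnj (\<gamma> y - z0)"
        if "t \<in> {0..1}" "x \<in> {0..1}" "y \<in> {0..1}" "0 \<le> u" "0 \<le> v" "u + v < 1" for t x y u v
        using star[OF that] by (auto simp: complex_eq_iff algebra_simps)
    qed (use abc total s in \<open>auto simp: \<rho>_def\<close>)
    then show ?thesis using s by (simp add: algebra_simps)
  qed
qed

section \<open>The tangent angle of a convex curve\<close>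

text \<open>
  By continuity \<open>h\<close> cannot pass from the value \<open>0\<close> through an interval on which the sine is negative.
\<close>

lemma sin_nonneg_stays_below_pi:
  fixes h :: "real \<Rightarrow> real"
  assumes ab: "a \<le> b" and cont: "continuous_on {a..b} h" and nonneg: "\<And>x. a \<le> x \<Longrightarrow> x \<le> b \<Longrightarrow> 0 \<le> sin (h x)"
    and zero: "h a = 0 \<or> h b = 0" and x: "a \<le> x" "x \<le> b"
  shows "0 \<le> h x \<and> h x \<le> pi"
proof -
  have no: False if v: "- pi < v \<and> v < 0 \<or> pi < v \<and> v < 2 * pi"
      and between: "h x \<le> v \<and> v \<le> 0 \<or> 0 \<le> v \<and> v \<le> h x" for v
  proof -
    have int: "is_interval (h ` {a..b})"
      using connected_continuous_image[OF cont] by (simp add: is_interval_connected_1)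
    have "h x \<in> h ` {a..b}" "0 \<in> h ` {a..b}" using x zero ab by force+
    then have "v \<in> h ` {a..b}"
      using int between unfolding is_interval_1 by blast
    then have "0 \<le> sin v" using nonneg by auto
    moreover have "sin v < 0" using v sin_lt_zero[of v] sin_gt_zero[of "- v"] by auto
    ultimately show False by simp
  qed
  have pi: "0 < pi" by (rule pi_gt_zero)
  have "0 \<le> h x"
  proof (rule ccontr)
    assume "\<not> 0 \<le> h x"
    then have "- pi < max (h x) (- pi / 2) \<and> max (h x) (- pi / 2) < 0"
      "h x \<le> max (h x) (- pi / 2) \<and> max (h x) (- pi / 2) \<le> 0" using pi by linarith+
    then show False using no by blast
  qed
  moreover have "h x \<le> pi"
  proof (rule ccontr)
    assume "\<not> h x \<le> pi"
    then have "pi < min (h x) (3 * pi / 2) \<and> min (h x) (3 * pi / 2) < 2 * pi"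
      "0 \<le> min (h x) (3 * pi / 2) \<and> min (h x) (3 * pi / 2) \<le> h x" using pi by linarith+
    then show False using no by blast
  qed
  ultimately show ?thesis by simp
qed

lemma Im_mult_cnj_exp: "Im (exp z * cnj (exp w)) = exp (Re z) * exp (Re w) * sin (Im z - Im w)"
  by (simp add: Re_exp Im_exp sin_diff algebra_simps)

text \<open>
  The chords \<open>r t - r s\<close> with \<open>s < t\<close> have a continuous argument \<open>A s t\<close>, because their parameters form
  a convex domain once the corner \<open>(0, l)\<close>, where the chord vanishes, is removed. Orientation
  says that the chord turns to the left, by at most \<open>pi\<close>, when either of its ends moves
  forward. Hence \<open>A s t\<close> decreases to a limit \<open>\<theta> s\<close> as \<open>t\<close> tends to \<open>s\<close>, and
  \<open>\<theta> s \<le> A s t \<le> \<theta> t\<close>. The chord from \<open>t\<close> to the end of the loop is opposite to the chord from its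
  start to \<open>t\<close>, which bounds the total turning by \<open>2 * pi\<close>.

  On a short arc to the right of \<open>s\<close> all chords have almost the direction \<open>\<theta> s\<close>, so the arc is hardly
  longer than its chord; this gives the right derivative \<open>cis (\<theta> s)\<close> its unit length.
\<close>

theorem oriented_loop_has_turning_tangent:
  fixes r :: "real \<Rightarrow> complex"
  assumes l: "0 < l" and closed: "r l = r 0" and inj: "inj_on r {0..<l}"
    and lip: "\<And>x y. 0 \<le> x \<Longrightarrow> x \<le> y \<Longrightarrow> y \<le> l \<Longrightarrow> dist (r x) (r y) \<le> y - x"
    and arc: "\<And>a b G. 0 \<le> a \<Longrightarrow> a \<le> b \<Longrightarrow> b \<le> l \<Longrightarrow>
      (\<And>x y. a \<le> x \<Longrightarrow> x \<le> y \<Longrightarrow> y \<le> b \<Longrightarrow> dist (r x) (r y) \<le> G y - G x) \<Longrightarrow> b - a \<le> G b - G a"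
    and oriented: "\<And>a b c. 0 \<le> a \<Longrightarrow> a < b \<Longrightarrow> b < c \<Longrightarrow> c \<le> l \<Longrightarrow>
      0 \<le> Im ((r c - r b) * cnj (r b - r a))"
  obtains \<theta> where "unit_speed_loop l r \<theta>"
proof -
  have cont: "continuous_on {0..l} r"
  proof (rule lipschitz_on_continuous_on)
    show "1-lipschitz_on {0..l} r"
    proof (rule lipschitz_onI)
      show "dist (r x) (r y) \<le> 1 * dist x y" if "x \<in> {0..l}" "y \<in> {0..l}" for x y
        using lip[of x y] lip[of y x] that by (cases "x \<le> y") (auto simp: dist_real_def dist_commute)
    qed simp
  qed
  define D where "D = {p. 0 \<le> fst p \<and> fst p < snd p \<and> snd p \<le> l \<and> p \<noteq> (0, l)}"
  have "convex D"
  proof (rule convexI)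
    fix p q :: "real \<times> real" and u v :: real
    assume p: "p \<in> D" and q: "q \<in> D" and uv: "0 \<le> u" "0 \<le> v" "u + v = 1"
    obtain p1 p2 q1 q2 where pq: "p = (p1, p2)" "q = (q1, q2)" by (cases p, cases q)
    \<comment> \<open>the width \<open>snd - fst\<close> is affine, lies in \<open>{0..l}\<close> and equals \<open>l\<close> only at the removed corner\<close>
    have w: "0 < p2 - p1" "p2 - p1 < l" "0 < q2 - q1" "q2 - q1 < l"
      using p q by (auto simp: D_def pq)
    have u: "u = 1 - v" using uv by simp
    have w0: "0 < u * (p2 - p1) + v * (q2 - q1)" "u * (p2 - p1) + v * (q2 - q1) < l"
      using convex_bound_lt[of "p2 - p1" l "q2 - q1" u v] convex_bound_lt[of "- (p2 - p1)" 0 "- (q2 - q1)" u v] w uv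
      by (auto simp: algebra_simps)
    have "0 \<le> u * p1 + v * q1" using p q uv by (auto simp: D_def pq)
    moreover have "u * p2 + v * q2 \<le> l"
      using convex_bound_le[of p2 l q2 u v] p q uv by (auto simp: D_def pq)
    ultimately show "u *\<^sub>R p + v *\<^sub>R q \<in> D"
      using w0 by (auto simp: D_def pq algebra_simps)
  qed
  then have "contractible D" by (rule convex_imp_contractible)
  moreover have "continuous_on D (\<lambda>p. r (snd p) - r (fst p))"
    by (intro continuous_intros continuous_on_compose2[OF cont]) (auto simp: D_def)
  moreover have "r (snd p) - r (fst p) \<noteq> 0" if p: "p \<in> D" for p
  proof -
    have "r (fst p) \<noteq> r (snd p)"
    proof (cases "snd p = l")
      case True
      then have "0 < fst p" "fst p < l" using p by (auto simp: D_def prod_eq_iff)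
      then show ?thesis using inj_onD[OF inj, of "fst p" 0] True closed l by auto
    next
      case False
      then show ?thesis using inj_onD[OF inj, of "fst p" "snd p"] p by (auto simp: D_def)
    qed
    then show ?thesis by simp
  qed
  ultimately obtain g where g: "continuous_on D g" "\<And>p. p \<in> D \<Longrightarrow> r (snd p) - r (fst p) = exp (g p)"
    using continuous_logarithm_on_contractible[of D "\<lambda>p. r (snd p) - r (fst p)"] by blast
  define A where "A s t = Im (g (s, t))" for s t
  have contA: "continuous_on S (\<lambda>x. A (f x) (h x))"
    if "continuous_on S f" "continuous_on S h" "\<And>x. x \<in> S \<Longrightarrow> (f x, h x) \<in> D" for S and f h :: "real \<Rightarrow> real"
    unfolding A_def
    by (intro continuous_on_Im continuous_on_compose2[OF g(1)] continuous_on_Pair that) (use that(3) in auto)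
  have chord: "r t - r s = dist (r s) (r t) *\<^sub>R cis (A s t)" if "(s, t) \<in> D" for s t
  proof -
    have e: "r t - r s = exp (g (s, t))" using g(2)[OF that] by simp
    then have "dist (r s) (r t) = exp (Re (g (s, t)))" by (metis dist_commute dist_norm norm_exp_eq_Re)
    then show ?thesis unfolding e by (simp add: A_def exp_eq_polar scaleR_conv_of_real)
  qed
  have sin_chords: "0 \<le> sin (A p q - A s t)"
    if "(s, t) \<in> D" "(p, q) \<in> D" "0 \<le> Im ((r q - r p) * cnj (r t - r s))" for p q s t
  proof -
    have "0 \<le> Im (exp (g (p, q)) * cnj (exp (g (s, t))))"
      using that(3) by (simp only: g(2)[OF that(1), simplified] g(2)[OF that(2), simplified])
    then show ?thesis by (simp only: Im_mult_cnj_exp A_def) (auto simp: zero_le_mult_iff mult_le_0_iff)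
  qed
  have turn_right_end: "A s t \<le> A s u \<and> A s u \<le> A s t + pi"
    if stu: "0 \<le> s" "s < t" "t \<le> u" "u \<le> l" "(s, u) \<noteq> (0, l)" for s t u
  proof -
    have inD: "(s, x) \<in> D" if "t \<le> x" "x \<le> u" for x using stu that by (auto simp: D_def)
    have "0 \<le> A s u - A s t \<and> A s u - A s t \<le> pi"
    proof (rule sin_nonneg_stays_below_pi[of t u "\<lambda>x. A s x - A s t"])
      show "continuous_on {t..u} (\<lambda>x. A s x - A s t)"
        by (intro continuous_intros contA) (use inD in auto)
      show "0 \<le> sin (A s x - A s t)" if x: "t \<le> x" "x \<le> u" for x
      proof (cases "x = t")
        case False
        have "Im ((r x - r s) * cnj (r t - r s)) = Im ((r x - r t) * cnj (r t - r s))"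
          by (simp add: algebra_simps)
        also have "\<dots> \<ge> 0" using False x stu by (intro oriented) auto
        finally show ?thesis using inD x stu by (intro sin_chords) auto
      qed simp
    qed (use stu in auto)
    then show ?thesis by linarith
  qed
  have turn_left_end: "A s u \<le> A t u \<and> A t u \<le> A s u + pi"
    if stu: "0 \<le> s" "s \<le> t" "t < u" "u \<le> l" "(s, u) \<noteq> (0, l)" for s t u
  proof -
    have inD: "(x, u) \<in> D" if "s \<le> x" "x \<le> t" for x using stu that by (auto simp: D_def)
    have "0 \<le> A t u - A s u \<and> A t u - A s u \<le> pi"
    proof (rule sin_nonneg_stays_below_pi[of s t "\<lambda>x. A t u - A x u"])
      show "continuous_on {s..t} (\<lambda>x. A t u - A x u)"
        by (intro continuous_intros contA) (use inD in auto)
      show "0 \<le> sin (A t u - A x u)" if x: "s \<le> x" "x \<le> t" for x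
      proof (cases "x = t")
        case False
        have "Im ((r u - r t) * cnj (r u - r x)) = Im ((r u - r t) * cnj (r t - r x))"
          by (simp add: algebra_simps)
        also have "\<dots> \<ge> 0" using False x stu by (intro oriented) auto
        finally show ?thesis using inD x stu by (intro sin_chords) auto
      qed simp
    qed (use stu in auto)
    then show ?thesis by linarith
  qed
  \<comment> \<open>the chord closing the loop points backwards, half a turn after the chord from the start\<close>
  have half_turn: "A t l = A 0 t + pi" if t: "0 < t" "t < l" for t
  proof -
    have D: "(0, t) \<in> D" "(t, l) \<in> D" using t by (auto simp: D_def)
    have lim: "((\<lambda>u. A t u) \<longlongrightarrow> A t l) (at_left l)"
    proof -
      have "continuous_on {(t + l) / 2..l} (\<lambda>u. A t u)"
        by (intro contA continuous_intros) (use t in \<open>auto simp: D_def\<close>)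
      then show ?thesis
        using t by (simp add: continuous_on_Icc_at_leftD)
    qed
    have near: "eventually (\<lambda>u. u \<in> {t<..<l}) (at_left l)"
      by (rule eventually_at_left_real[OF t(2)])
    have lower: "A 0 t \<le> A t l"
    proof (rule tendsto_lowerbound[OF lim])
      show "eventually (\<lambda>u. A 0 t \<le> A t u) (at_left l)"
        using near
      proof eventually_elim
        case (elim u)
        then show ?case using turn_right_end[of 0 t u] turn_left_end[of 0 t u] t by auto
      qed
    qed simp
    have upper: "A t l \<le> A 0 t + 2 * pi"
    proof (rule tendsto_upperbound[OF lim])
      show "eventually (\<lambda>u. A t u \<le> A 0 t + 2 * pi) (at_left l)"
        using near
      proof eventually_elim
        case (elim u)
        then show ?case using turn_right_end[of 0 t u] turn_left_end[of 0 t u] t by auto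
      qed
    qed simp
    have pos: "0 < dist (r 0) (r t)" "dist (r t) (r l) = dist (r 0) (r t)"
      using inj_onD[OF inj, of 0 t] t closed by (auto simp: dist_commute)
    have "dist (r 0) (r t) *\<^sub>R cis (A t l) = - (dist (r 0) (r t) *\<^sub>R cis (A 0 t))"
      using chord[OF D(1)] chord[OF D(2)] closed pos(2) by (metis minus_diff_eq)
    then have "cis (A t l) = - cis (A 0 t)"
      using pos(1) by (metis scaleR_minus_right scaleR_cancel_left less_irrefl)
    then have "cis (A t l - A 0 t) = -1"
      by (simp add: cis_divide[symmetric])
    then have "cos (A t l - A 0 t) = -1" by (simp add: complex_eq_iff)
    then have "cos (A t l - A 0 t - pi) = 1" by (simp add: cos_diff)
    moreover have "\<bar>A t l - A 0 t - pi\<bar> \<le> pi" using lower upper by linarith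
    ultimately have "A t l - A 0 t - pi = 0"
      using cos_monotone_0_pi[of 0 "\<bar>A t l - A 0 t - pi\<bar>"] by force
    then show ?thesis by simp
  qed
  define \<theta> where "\<theta> s = Inf (A s ` {s<..<l})" for s
  have \<theta>_bdd: "bdd_below (A s ` {s<..<l})" if s: "0 \<le> s" "s < l" for s
  proof -
    define m where "m = (s + l) / 2"
    have m: "s < m" "m < l" using s by (auto simp: m_def)
    have "A s m - pi \<le> A s t" if "t \<in> {s<..<l}" for t
      using turn_right_end[of s m t] turn_right_end[of s t m] that s m pi_gt_zero
      by (cases "t \<le> m") auto
    then show ?thesis by (intro bdd_belowI2[of _ "A s m - pi"]) auto
  qed
  have \<theta>_le: "\<theta> s \<le> A s t" if "0 \<le> s" "s < t" "t \<le> l" "(s, t) \<noteq> (0, l)" for s t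
  proof -
    define m where "m = (s + t) / 2"
    have m: "s < m" "m < t" using that by (auto simp: m_def)
    have "\<theta> s \<le> A s m"
      unfolding \<theta>_def using that m \<theta>_bdd[of s] by (intro cInf_lower) auto
    also have "\<dots> \<le> A s t" using turn_right_end[of s m t] that m by auto
    finally show ?thesis .
  qed
  have \<theta>_ge: "k \<le> \<theta> s" if "s < l" "\<And>t. s < t \<Longrightarrow> t < l \<Longrightarrow> k \<le> A s t" for s k
    unfolding \<theta>_def using that by (intro cInf_greatest) auto
  have A_le_\<theta>: "A s t \<le> \<theta> t" if "0 \<le> s" "s < t" "t < l" for s t
  proof (rule \<theta>_ge)
    show "A s t \<le> A t u" if "t < u" "u < l" for u
      using turn_right_end[of s t u] turn_left_end[of s t u] \<open>0 \<le> s\<close> \<open>s < t\<close> that by auto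
  qed (use that in auto)
  have right_derivative: "(r has_vector_derivative cis (\<theta> s)) (at_right s)" if s: "0 \<le> s" "s < l" for s
  proof -
    have est: "\<exists>u0. s < u0 \<and> u0 < l \<and> (\<forall>u. s < u \<and> u \<le> u0 \<longrightarrow>
        norm ((r u - r s) /\<^sub>R (u - s) - cis (\<theta> s)) \<le> e)" if e: "0 < e" for e
    proof -
      \<comment> \<open>a vector of norm at most \<open>1\<close> with component at least \<open>k\<close> along a unit vector is within \<open>e\<close> of it\<close>
      define k where "k = max 0 (1 - e\<^sup>2 / 2)"
      have k: "0 \<le> k" "k < 1" "2 - 2 * k \<le> e\<^sup>2" using e by (auto simp: k_def max_def field_simps)
      define \<epsilon> where "\<epsilon> = arccos k"
      have \<epsilon>: "0 < \<epsilon>" "\<epsilon> \<le> pi" "cos \<epsilon> = k"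
        using k arccos_lt_bounded[of k] cos_arccos[of k] by (auto simp: \<epsilon>_def)
      obtain c where c: "s < c" "c < l" "A s c < \<theta> s + \<epsilon>"
      proof -
        have "A s ` {s<..<l} \<noteq> {}" using s by auto
        then show thesis using that cInf_less_iff[OF _ \<theta>_bdd[OF s], of "\<theta> s + \<epsilon>"] \<epsilon>(1)
          by (force simp: \<theta>_def)
      qed
      obtain u0 where u0: "s < u0" "u0 < c" "A u0 c < \<theta> s + \<epsilon>"
      proof -
        have "continuous_on {s..(s + c) / 2} (\<lambda>u. A u c)"
          by (intro contA continuous_intros) (use s c in \<open>auto simp: D_def\<close>)
        then have "((\<lambda>u. A u c) \<longlongrightarrow> A s c) (at_right s)"
          by (rule continuous_on_Icc_at_rightD) (use c in auto)
        then have "eventually (\<lambda>u. A u c < \<theta> s + \<epsilon>) (at_right s)"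
          using c(3) by (rule order_tendstoD(2))
        moreover have "eventually (\<lambda>u. u \<in> {s<..<c}) (at_right s)"
          by (rule eventually_at_right_real[OF c(1)])
        ultimately have "eventually (\<lambda>u. A u c < \<theta> s + \<epsilon> \<and> u \<in> {s<..<c}) (at_right s)"
          by eventually_elim auto
        then show thesis using that eventually_happens'[of "at_right s"] by auto
      qed
      have ang: "\<bar>A x y - \<theta> s\<bar> \<le> \<epsilon>" if xy: "s \<le> x" "x < y" "y \<le> u0" for x y
      proof -
        have "\<theta> s \<le> A s y" using \<theta>_le[of s y] xy s u0 c by auto
        also have "\<dots> \<le> A x y" using turn_left_end[of s x y] xy s u0 c by auto
        finally have "\<theta> s \<le> A x y" .
        moreover have "A x y \<le> A x c" using turn_right_end[of x y c] xy s u0 c by auto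
        moreover have "A x c \<le> A u0 c" using turn_left_end[of x u0 c] xy s u0 c by auto
        ultimately show ?thesis using u0(3) by simp
      qed
      have Re_chord: "k * dist (r x) (r y) \<le> Re (cis (- \<theta> s) * r y) - Re (cis (- \<theta> s) * r x)"
        if xy: "s \<le> x" "x \<le> y" "y \<le> u0" for x y
      proof (cases "x = y")
        case False
        then have D: "(x, y) \<in> D" using xy s u0 c by (auto simp: D_def)
        have "k \<le> cos (A x y - \<theta> s)"
          using cos_monotone_0_pi_le[of "\<bar>A x y - \<theta> s\<bar>" \<epsilon>] ang[of x y] False xy \<epsilon> by simp
        then have "k * dist (r x) (r y) \<le> cos (A x y - \<theta> s) * dist (r x) (r y)"
          by (intro mult_right_mono) auto
        also have "\<dots> = Re (cis (- \<theta> s) * (r y - r x))"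
          unfolding chord[OF D] by (simp add: cos_diff algebra_simps)
        finally show ?thesis by (simp add: algebra_simps)
      qed simp
      have "norm ((r u - r s) /\<^sub>R (u - s) - cis (\<theta> s)) \<le> e" if u: "s < u" "u \<le> u0" for u
      proof -
        define w where "w = (r u - r s) /\<^sub>R (u - s)"
        have "norm w \<le> 1"
          using lip[of s u] u s u0 c by (simp add: w_def dist_norm norm_minus_commute divide_simps)
        have "k * (u - s) \<le> Re (cis (- \<theta> s) * (r u - r s))"
        proof (cases "k = 0")
          case True
          then show ?thesis using Re_chord[of s u] u by (simp add: algebra_simps)
        next
          case False
          then have "0 < k" using k by simp
          have "u - s \<le> Re (cis (- \<theta> s) * r u) / k - Re (cis (- \<theta> s) * r s) / k"
          proof (rule arc)
            fix x y assume xy: "s \<le> x" "x \<le> y" "y \<le> u"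
            then have "k * dist (r x) (r y) \<le> Re (cis (- \<theta> s) * r y) - Re (cis (- \<theta> s) * r x)"
              using u by (intro Re_chord) auto
            then show "dist (r x) (r y) \<le> Re (cis (- \<theta> s) * r y) / k - Re (cis (- \<theta> s) * r x) / k"
              using \<open>0 < k\<close> by (simp add: diff_divide_distrib[symmetric] pos_le_divide_eq mult.commute)
          qed (use s u u0 c in auto)
          then have "(u - s) * k \<le> Re (cis (- \<theta> s) * r u) - Re (cis (- \<theta> s) * r s)"
            using \<open>0 < k\<close> by (simp only: diff_divide_distrib[symmetric] pos_le_divide_eq)
          then show ?thesis by (simp add: algebra_simps)
        qed
        moreover have "Re (cis (- \<theta> s) * w) = Re (cis (- \<theta> s) * (r u - r s)) / (u - s)"
          by (simp add: w_def diff_divide_distrib divide_inverse algebra_simps)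
        ultimately have Re_w: "k \<le> Re (cis (- \<theta> s) * w)" using u by (simp add: pos_le_divide_eq)
        have "(norm (w - cis (\<theta> s)))\<^sup>2 = (Re w - cos (\<theta> s))\<^sup>2 + (Im w - sin (\<theta> s))\<^sup>2"
          by (simp add: cmod_power2)
        also have "\<dots> = ((Re w)\<^sup>2 + (Im w)\<^sup>2) + ((sin (\<theta> s))\<^sup>2 + (cos (\<theta> s))\<^sup>2)
            - 2 * (cos (\<theta> s) * Re w + sin (\<theta> s) * Im w)"
          by (simp only: power2_eq_square) (simp add: algebra_simps)
        also have "\<dots> = (norm w)\<^sup>2 + 1 - 2 * Re (cis (- \<theta> s) * w)"
          by (simp add: cmod_power2)
        also have "\<dots> \<le> e\<^sup>2"
        proof -
          have "(norm w)\<^sup>2 \<le> 1" using \<open>norm w \<le> 1\<close> by (simp add: power_le_one)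
          then show ?thesis using Re_w k(3) by linarith
        qed
        finally have "norm (w - cis (\<theta> s)) \<le> e" by (rule power2_le_imp_le) (use e in simp)
        then show ?thesis by (simp only: w_def)
      qed
      then show ?thesis using u0 c by (intro exI[of _ u0]) auto
    qed
    have "((\<lambda>u. (r u - r s) /\<^sub>R (u - s)) \<longlongrightarrow> cis (\<theta> s)) (at_right s)"
    proof (rule tendstoI)
      fix e :: real assume e: "0 < e"
      obtain u0 where u0: "s < u0" "\<And>u. s < u \<Longrightarrow> u \<le> u0 \<Longrightarrow> norm ((r u - r s) /\<^sub>R (u - s) - cis (\<theta> s)) \<le> e / 2"
        using est[of "e / 2"] e by auto
      have "eventually (\<lambda>u. u \<in> {s<..<u0}) (at_right s)"
        by (rule eventually_at_right_real[OF u0(1)])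
      then show "eventually (\<lambda>u. dist ((r u - r s) /\<^sub>R (u - s)) (cis (\<theta> s)) < e) (at_right s)"
      proof eventually_elim
        case (elim u)
        then show ?case using u0(2)[of u] e by (simp add: dist_norm)
      qed
    qed
    then have "((\<lambda>u. (r u - r s) /\<^sub>R (u - s) - cis (\<theta> s)) \<longlongrightarrow> 0) (at_right s)"
      by (rule LIM_zero)
    moreover have "eventually (\<lambda>u. (r u - r s) /\<^sub>R (u - s) - cis (\<theta> s) =
        (1 / \<bar>u - s\<bar>) *\<^sub>R (r u - (r s + (u - s) *\<^sub>R cis (\<theta> s)))) (at_right s)"
      using eventually_at_right_less[of s]
    proof eventually_elim
      case (elim u)
      have "(1 / \<bar>u - s\<bar>) *\<^sub>R (r u - (r s + (u - s) *\<^sub>R cis (\<theta> s)))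
          = (1 / (u - s)) *\<^sub>R (r u - r s) - (1 / (u - s)) *\<^sub>R (u - s) *\<^sub>R cis (\<theta> s)"
        using elim by (simp only: abs_of_pos diff_gt_0_iff_gt diff_diff_eq[symmetric] scaleR_diff_right)
      then show ?case using elim by (simp add: divide_inverse)
    qed
    ultimately have "((\<lambda>u. (1 / \<bar>u - s\<bar>) *\<^sub>R (r u - (r s + (u - s) *\<^sub>R cis (\<theta> s)))) \<longlongrightarrow> 0) (at_right s)"
      by (rule Lim_transform_eventually)
    then show ?thesis
      by (simp add: has_vector_derivative_def has_derivative_within bounded_linear_scaleR_left)
  qed
  have "unit_speed_loop l r \<theta>"
  proof
    show "\<theta> x \<le> \<theta> y" if "0 \<le> x" "x \<le> y" "y < l" for x y
    proof (cases "x = y")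
      case False
      then show ?thesis using \<theta>_le[of x y] A_le_\<theta>[of x y] that by auto
    qed simp
    show "\<theta> x \<le> \<theta> 0 + 2 * pi" if x: "0 \<le> x" "x < l" for x
    proof (cases "x = 0")
      case False
      have "\<theta> x \<le> A x l" using \<theta>_le[of x l] x False by auto
      also have "\<dots> = A 0 x + pi" using half_turn[of x] x False by simp
      finally have "\<theta> x \<le> A 0 x + pi" .
      moreover have "A 0 x - pi \<le> \<theta> 0"
      proof (rule \<theta>_ge)
        show "A 0 x - pi \<le> A 0 t" if "0 < t" "t < l" for t
          using turn_right_end[of 0 x t] turn_right_end[of 0 t x] that x False
          by (cases "t \<le> x") auto
      qed (rule l)
      ultimately show ?thesis by simp
    qed simp
    show "(r has_vector_derivative 1 *\<^sub>R cis (\<theta> x)) (at_right x)" if "0 \<le> x" "x < l" for x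
      using right_derivative[OF that] by simp
  qed (use l cont closed lip inj in auto)
  then show thesis by (rule that)
qed

section \<open>Isometric combinations\<close>

text \<open>
  The conclusion for the sum in a form that is invariant under reflection; this reduces clockwise
  curves to counterclockwise ones.
\<close>

definition supported_loop :: "real \<Rightarrow> (real \<Rightarrow> complex) \<Rightarrow> bool" where
  "supported_loop l R \<longleftrightarrow> continuous_on {0..l} R \<and> R l = R 0 \<and> inj_on R {0..<l} \<and>
     (\<forall>s\<in>{0..l}. \<exists>n. n \<noteq> 0 \<and> (\<forall>x\<in>{0..l}. inner n (R s) \<le> inner n (R x)))"

lemma (in turning_loop) supported_loop_if_inj:
  assumes "inj_on r {0..<l}"
  shows "supported_loop l r"
proof -
  have supp: "\<exists>n. n \<noteq> 0 \<and> (\<forall>x\<in>{0..l}. inner n (r s) \<le> inner n (r x))" if s: "0 \<le> s" "s < l" for s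
  proof (intro exI conjI ballI)
    show "\<i> * cis (\<phi> s) \<noteq> 0" by simp
    show "inner (\<i> * cis (\<phi> s)) (r s) \<le> inner (\<i> * cis (\<phi> s)) (r x)" if "x \<in> {0..l}" for x
      using left_of_tangent[OF s, of x] that by (simp add: across_def inner_complex_def)
  qed
  have "\<exists>n. n \<noteq> 0 \<and> (\<forall>x\<in>{0..l}. inner n (r s) \<le> inner n (r x))" if "s \<in> {0..l}" for s
    using supp[of s] supp[of 0] that closed l_pos by (cases "s = l") auto
  then show ?thesis using cont closed assms by (simp add: supported_loop_def)
qed

lemma supported_loop_cnj:
  assumes "supported_loop l R"
  shows "supported_loop l (\<lambda>x. cnj (R x))"
  unfolding supported_loop_def
proof (intro conjI ballI)
  show "continuous_on {0..l} (\<lambda>x. cnj (R x))"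
    using assms by (auto simp: supported_loop_def intro: continuous_on_cnj)
  show "inj_on (\<lambda>x. cnj (R x)) {0..<l}" using assms by (simp add: supported_loop_def inj_on_def)
  show "cnj (R l) = cnj (R 0)" using assms by (simp add: supported_loop_def)
  fix s assume "s \<in> {0..l}"
  then obtain n where n: "n \<noteq> 0" "\<forall>x\<in>{0..l}. inner n (R s) \<le> inner n (R x)"
    using assms unfolding supported_loop_def by blast
  have "inner (cnj n) (cnj z) = inner n z" for z by (simp add: inner_complex_def)
  then have "\<forall>x\<in>{0..l}. inner (cnj n) (cnj (R s)) \<le> inner (cnj n) (cnj (R x))" using n(2) by simp
  moreover have "cnj n \<noteq> 0" using n(1) by simp
  ultimately show "\<exists>n. n \<noteq> 0 \<and> (\<forall>x\<in>{0..l}. inner n (cnj (R s)) \<le> inner n (cnj (R x)))" by blast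
qed

lemma supported_loop_imp_simple_closed_convex_curve:
  assumes l: "0 < l" and R: "supported_loop l R" and g: "\<And>t. t \<in> {0..1} \<Longrightarrow> g t = R (l * t)"
  shows "simple_closed_convex_curve g"
proof (rule supporting_lines_imp_simple_closed_convex_curve)
  have scale: "l * t \<in> {0..l}" if "t \<in> {0..1}" for t
    using that l by (simp add: mult_left_le)
  have "continuous_on {0..1} (\<lambda>t. R (l * t))"
    by (rule continuous_on_compose2[of "{0..l}" R])
      (use R scale in \<open>auto simp: supported_loop_def intro!: continuous_intros\<close>)
  then show "path g" unfolding path_def by (rule continuous_on_eq) (use g in simp)
  show "pathfinish g = pathstart g"
    using g R by (simp add: pathfinish_def pathstart_def supported_loop_def)
  show "inj_on g {0..<1}"
  proof (rule inj_onI)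
    fix x y :: real assume xy: "x \<in> {0..<1}" "y \<in> {0..<1}" "g x = g y"
    then have "R (l * x) = R (l * y)" using g by simp
    then have "l * x = l * y"
      by (rule inj_onD[of R "{0..<l}", rotated]) (use R xy l in \<open>auto simp: supported_loop_def\<close>)
    then show "x = y" using l by simp
  qed
  fix s :: real assume s: "s \<in> {0..1}"
  then obtain n where "n \<noteq> 0" "\<forall>x\<in>{0..l}. inner n (R (l * s)) \<le> inner n (R x)"
    using R scale[OF s] unfolding supported_loop_def by blast
  then show "\<exists>n. n \<noteq> 0 \<and> (\<forall>x\<in>{0..1}. inner n (g s) \<le> inner n (g x))"
    using g s scale by auto
qed

lemma curve_length_rotate: "curve_length ((\<lambda>z. cis \<alpha> * z) \<circ> \<gamma>) a b = curve_length \<gamma> a b"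
proof -
  have "dist (cis \<alpha> * x) (cis \<alpha> * y) = dist x y" for x y
    by (simp add: dist_norm right_diff_distrib[symmetric] norm_mult)
  then show ?thesis by (simp add: curve_length_def)
qed

text \<open>
  A clockwise curve (\<open>\<sigma> = - 1\<close>) has a decreasing tangent angle; its mirror image is a unit-speed loop.
  The rotation is carried along because the isometric combination takes the arc points of the
  rotated curve.
\<close>

lemma convex_curve_arc_point:
  assumes conv: "simple_closed_convex_curve \<gamma>" and z0: "z0 \<in> inside (path_image \<gamma>)"
    and wn: "winding_number \<gamma> z0 = of_real \<sigma>" and \<sigma>: "\<sigma> = 1 \<or> \<sigma> = - 1"
    and len: "curve_length \<gamma> 0 1 = ereal l"
  obtains r \<theta> where "0 < l"
    and "\<And>\<alpha> s. s \<in> {0..l} \<Longrightarrow> arc_point ((\<lambda>z. cis \<alpha> * z) \<circ> \<gamma>) s = cis \<alpha> * r s"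
    and "\<sigma> = 1 \<Longrightarrow> unit_speed_loop l r \<theta>"
    and "\<sigma> = - 1 \<Longrightarrow> unit_speed_loop l (\<lambda>x. cnj (r x)) \<theta>"
proof -
  have simple: "simple_path \<gamma>" and loop: "\<gamma> 1 = \<gamma> 0"
    using conv by (auto simp: simple_closed_convex_curve_def pathfinish_def pathstart_def)
  obtain \<tau> where \<tau>: "\<tau> ` {0..l} \<subseteq> {0..1}" "strict_mono_on {0..l} \<tau>" "\<tau> 0 = 0" "\<tau> l = 1" "0 < l"
    and \<tau>_len: "\<And>s. s \<in> {0..l} \<Longrightarrow> curve_length \<gamma> 0 (\<tau> s) = ereal s"
    and \<tau>_unique: "\<And>s t. t \<in> {0..1} \<Longrightarrow> curve_length \<gamma> 0 t = ereal s \<Longrightarrow> s \<in> {0..l} \<and> t = \<tau> s"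
    and lip: "\<And>x y. 0 \<le> x \<Longrightarrow> x \<le> y \<Longrightarrow> y \<le> l \<Longrightarrow> dist (\<gamma> (\<tau> x)) (\<gamma> (\<tau> y)) \<le> y - x"
    and arc: "\<And>a b G. 0 \<le> a \<Longrightarrow> a \<le> b \<Longrightarrow> b \<le> l \<Longrightarrow>
      (\<And>x y. a \<le> x \<Longrightarrow> x \<le> y \<Longrightarrow> y \<le> b \<Longrightarrow> dist (\<gamma> (\<tau> x)) (\<gamma> (\<tau> y)) \<le> G y - G x)
      \<Longrightarrow> b - a \<le> G b - G a"
    by (rule arc_length_parametrization[OF simple len]) blast
  define r where "r s = \<gamma> (\<tau> s)" for s
  have less: "\<tau> x < \<tau> y" if "0 \<le> x" "x < y" "y \<le> l" for x y
    using \<tau>(2) that by (auto simp: strict_mono_on_def)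
  have inj: "inj_on r {0..<l}"
  proof (rule linorder_inj_onI)
    fix x y assume xy: "x < y" "x \<in> {0..<l}" "y \<in> {0..<l}"
    then have "\<tau> x < \<tau> y" "\<tau> y < 1" "0 \<le> \<tau> x"
      using less[of x y] less[of y l] \<tau>(1,4) by (auto simp: image_subset_iff)
    moreover from this have "\<tau> x \<in> {0..1}" "\<tau> y \<in> {0..1}" by auto
    then have "r x = r y \<Longrightarrow> \<tau> x = \<tau> y \<or> \<tau> x = 0 \<and> \<tau> y = 1 \<or> \<tau> x = 1 \<and> \<tau> y = 0"
      using simple unfolding simple_path_def loop_free_def r_def by blast
    ultimately show "r x \<noteq> r y" by linarith
  qed auto
  have closed: "r l = r 0" using loop \<tau>(3,4) by (simp add: r_def)
  have lip_r: "dist (r x) (r y) \<le> y - x" if "0 \<le> x" "x \<le> y" "y \<le> l" for x y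
    using lip[OF that] by (simp add: r_def)
  have arc_r: "b - a \<le> G b - G a" if "0 \<le> a" "a \<le> b" "b \<le> l"
    "\<And>x y. a \<le> x \<Longrightarrow> x \<le> y \<Longrightarrow> y \<le> b \<Longrightarrow> dist (r x) (r y) \<le> G y - G x" for a b and G :: "real \<Rightarrow> real"
    using that unfolding r_def by (rule arc)
  have or: "0 \<le> \<sigma> * Im ((r c - r b) * cnj (r b - r a))" if abc: "0 \<le> a" "a < b" "b < c" "c \<le> l" for a b c
  proof -
    have "\<tau> a \<in> {0..1}" "\<tau> c \<in> {0..1}" using \<tau>(1) abc by (auto simp: image_subset_iff)
    then have "0 \<le> \<tau> a" "\<tau> a < \<tau> b" "\<tau> b < \<tau> c" "\<tau> c \<le> 1"
      using less[of a b] less[of b c] abc by auto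
    then show ?thesis unfolding r_def by (rule convex_curve_oriented[OF conv z0 wn \<sigma>])
  qed
  have point: "arc_point ((\<lambda>z. cis \<alpha> * z) \<circ> \<gamma>) s = cis \<alpha> * r s" if s: "s \<in> {0..l}" for \<alpha> s
    unfolding arc_point_def
  proof (rule the_equality)
    show "\<exists>t\<in>{0..1}. cis \<alpha> * r s = ((\<lambda>z. cis \<alpha> * z) \<circ> \<gamma>) t \<and> curve_length ((\<lambda>z. cis \<alpha> * z) \<circ> \<gamma>) 0 t = ereal s"
      by (rule bexI[of _ "\<tau> s"]) (use s \<tau>(1) \<tau>_len[OF s] in \<open>auto simp: curve_length_rotate r_def image_subset_iff\<close>)
    show "p = cis \<alpha> * r s"
      if "\<exists>t\<in>{0..1}. p = ((\<lambda>z. cis \<alpha> * z) \<circ> \<gamma>) t \<and> curve_length ((\<lambda>z. cis \<alpha> * z) \<circ> \<gamma>) 0 t = ereal s" for p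
      using that \<tau>_unique by (auto simp: curve_length_rotate r_def)
  qed
  show thesis
    using \<sigma>
  proof
    assume s: "\<sigma> = 1"
    obtain \<theta> where "unit_speed_loop l r \<theta>"
    proof (rule oriented_loop_has_turning_tangent[of l r])
      show "b - a \<le> G b - G a" if "0 \<le> a" "a \<le> b" "b \<le> l"
        "\<And>x y. a \<le> x \<Longrightarrow> x \<le> y \<Longrightarrow> y \<le> b \<Longrightarrow> dist (r x) (r y) \<le> G y - G x"
        for a b and G :: "real \<Rightarrow> real"
        using that by (rule arc_r)
      show "0 \<le> Im ((r c - r b) * cnj (r b - r a))" if "0 \<le> a" "a < b" "b < c" "c \<le> l" for a b c
        using or[OF that] s by simp
    qed (use \<tau>(5) closed inj lip_r in blast)+
    then show thesis by (intro that[OF \<tau>(5) point]) (use s in simp_all)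
  next
    assume s: "\<sigma> = - 1"
    have d: "dist (cnj x) (cnj y) = dist x y" for x y
      by (metis complex_cnj_diff complex_mod_cnj dist_norm)
    obtain \<theta> where "unit_speed_loop l (\<lambda>x. cnj (r x)) \<theta>"
    proof (rule oriented_loop_has_turning_tangent[of l "\<lambda>x. cnj (r x)"])
      show "cnj (r l) = cnj (r 0)" using closed by simp
      show "inj_on (\<lambda>x. cnj (r x)) {0..<l}" using inj by (simp add: inj_on_def)
      show "dist (cnj (r x)) (cnj (r y)) \<le> y - x" if "0 \<le> x" "x \<le> y" "y \<le> l" for x y
        using lip_r[OF that] by (simp add: d)
      show "b - a \<le> G b - G a" if "0 \<le> a" "a \<le> b" "b \<le> l"
        "\<And>x y. a \<le> x \<Longrightarrow> x \<le> y \<Longrightarrow> y \<le> b \<Longrightarrow> dist (cnj (r x)) (cnj (r y)) \<le> G y - G x"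
        for a b and G :: "real \<Rightarrow> real"
        using that unfolding d by (rule arc_r)
      show "0 \<le> Im ((cnj (r c) - cnj (r b)) * cnj (cnj (r b) - cnj (r a)))"
        if "0 \<le> a" "a < b" "b < c" "c \<le> l" for a b c
        using or[OF that] s by (simp add: algebra_simps)
    qed (use \<tau>(5) in blast)+
    then show thesis by (intro that[OF \<tau>(5) point]) (use s in simp_all)
  qed
qed

lemma orientation_preserving_isometry_rotate: "orientation_preserving_isometry (\<lambda>z. cis \<alpha> * z)"
  unfolding orientation_preserving_isometry_def
proof (intro conjI allI)
  show "dist (cis \<alpha> * x) (cis \<alpha> * y) = dist x y" for x y
    by (simp add: dist_norm right_diff_distrib[symmetric] norm_mult)
  show "0 < Re (cis \<alpha> * 1 - cis \<alpha> * 0) * Im (cis \<alpha> * \<i> - cis \<alpha> * 0)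
      - Im (cis \<alpha> * 1 - cis \<alpha> * 0) * Re (cis \<alpha> * \<i> - cis \<alpha> * 0)"
    using sin_cos_squared_add[of \<alpha>] by (simp add: power2_eq_square)
qed

theorem theorem3:
  fixes \<gamma>1 \<gamma>2 :: "real \<Rightarrow> complex" and s0 :: real
  assumes "simple_closed_convex_curve \<gamma>1" and "simple_closed_convex_curve \<gamma>2"
    and "same_orientation \<gamma>1 \<gamma>2"
    and "curve_length \<gamma>1 0 1 = ereal s0" and "curve_length \<gamma>2 0 1 = ereal s0"
  shows "\<exists>f. orientation_preserving_isometry f \<and>
             simple_closed_convex_curve (isometric_combination s0 (f \<circ> \<gamma>1) \<gamma>2)"
proof -
  have inside: "\<exists>z. z \<in> inside (path_image \<gamma>)" if "simple_closed_convex_curve \<gamma>" for \<gamma>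
    using Jordan_inside_outside[of \<gamma>] that by (auto simp: simple_closed_convex_curve_def)
  obtain z1 z2 where z: "z1 \<in> inside (path_image \<gamma>1)" "z2 \<in> inside (path_image \<gamma>2)"
    using inside assms(1,2) by meson
  have eq: "winding_number \<gamma>1 z1 = winding_number \<gamma>2 z2"
    using assms(3) z by (simp add: same_orientation_def)
  obtain \<sigma> :: real where \<sigma>: "\<sigma> = 1 \<or> \<sigma> = - 1" and w1: "winding_number \<gamma>1 z1 = of_real \<sigma>"
  proof -
    have "simple_path \<gamma>1" using assms(1) by (simp add: simple_closed_convex_curve_def)
    then consider "winding_number \<gamma>1 z1 = 1" | "winding_number \<gamma>1 z1 = - 1"
      using simple_closed_path_winding_number_inside z(1) by metis
    then show thesis
    proof cases
      case 1
      then show thesis using that[of 1] by simp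
    next
      case 2
      then show thesis using that[of "- 1"] by simp
    qed
  qed
  have w2: "winding_number \<gamma>2 z2 = of_real \<sigma>" using w1 eq by simp
  obtain r1 \<theta>1 where l: "0 < s0"
    and p1: "\<And>\<alpha> s. s \<in> {0..s0} \<Longrightarrow> arc_point ((\<lambda>z. cis \<alpha> * z) \<circ> \<gamma>1) s = cis \<alpha> * r1 s"
    and u1: "\<sigma> = 1 \<Longrightarrow> unit_speed_loop s0 r1 \<theta>1" "\<sigma> = - 1 \<Longrightarrow> unit_speed_loop s0 (\<lambda>x. cnj (r1 x)) \<theta>1"
    by (rule convex_curve_arc_point[OF assms(1) z(1) w1 \<sigma> assms(4)]) blast
  obtain r2 \<theta>2 where "0 < s0"
    and p2: "\<And>\<alpha> s. s \<in> {0..s0} \<Longrightarrow> arc_point ((\<lambda>z. cis \<alpha> * z) \<circ> \<gamma>2) s = cis \<alpha> * r2 s"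
    and u2: "\<sigma> = 1 \<Longrightarrow> unit_speed_loop s0 r2 \<theta>2" "\<sigma> = - 1 \<Longrightarrow> unit_speed_loop s0 (\<lambda>x. cnj (r2 x)) \<theta>2"
    by (rule convex_curve_arc_point[OF assms(2) z(2) w2 \<sigma> assms(5)]) blast
  have pair: "\<exists>\<alpha>. supported_loop s0 (\<lambda>x. cis \<alpha> * R1 x + R2 x)"
    if U: "unit_speed_loop s0 R1 \<theta>1" "unit_speed_loop s0 R2 \<theta>2" for R1 R2
  proof -
    interpret unit_speed_loop_pair s0 R1 \<theta>1 R2 \<theta>2
      using U by (simp add: unit_speed_loop_pair_def)
    show ?thesis
      using rotated_sum_is_convex_loop turning_loop.supported_loop_if_inj by metis
  qed
  obtain \<alpha> where \<alpha>: "supported_loop s0 (\<lambda>x. cis \<alpha> * r1 x + r2 x)"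
    using \<sigma>
  proof
    assume "\<sigma> = 1"
    then show thesis using pair[OF u1(1) u2(1)] that by blast
  next
    assume "\<sigma> = - 1"
    then obtain \<beta> where "supported_loop s0 (\<lambda>x. cis \<beta> * cnj (r1 x) + cnj (r2 x))"
      using pair[OF u1(2) u2(2)] by blast
    from supported_loop_cnj[OF this] show thesis
      by (intro that[of "- \<beta>"]) (simp add: cis_cnj)
  qed
  have "simple_closed_convex_curve (isometric_combination s0 ((\<lambda>z. cis \<alpha> * z) \<circ> \<gamma>1) \<gamma>2)"
  proof (rule supported_loop_imp_simple_closed_convex_curve[OF l \<alpha>])
    fix t :: real assume t: "t \<in> {0..1}"
    then have "s0 * t \<in> {0..s0}" using l by (simp add: mult_left_le)
    moreover have "(\<lambda>z. cis 0 * z) \<circ> \<gamma>2 = \<gamma>2" by (simp add: fun_eq_iff)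
    ultimately show "isometric_combination s0 ((\<lambda>z. cis \<alpha> * z) \<circ> \<gamma>1) \<gamma>2 t
        = cis \<alpha> * r1 (s0 * t) + r2 (s0 * t)"
      using p1 p2[of _ 0] by (simp add: isometric_combination_def)
  qed
  then show ?thesis using orientation_preserving_isometry_rotate by blast
qed

end
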